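(* Let $p$ be a prime and $d,m,n$ positive integers, and let $R$ be a finite local ring of order $p^{dn}$ whose maximal ideal $I$ is generated by an element $\pi$, with $\pi^{n-1}\neq 0$, $\pi^n=0$, $p=\pi^m u$ for some unit $u\in R$, and $R/I$ a finite field of order $p^d$. Let $h$ be a positive integer with prime factorization $h=\prod_{i=1}^r p_i^{e_i}$, and assume $$p^d\in p_1\mathbb{N}+\cdots+p_r\mathbb{N}.$$ Then a $\mathrm{BH}(R\times R,h)$ matrix exists, where $R\times R$ is regarded as an (additive) abelian group.
   Context: $\mathbb{N}=\{0,1,2,\dots\}$ and $p_1\mathbb{N}+\cdots+p_r\mathbb{N}$ is the set of integers $\sum_i p_i a_i$ with $a_i\in\mathbb{N}$. For a finite group $G$, a $|G|\times|G|$ matrix $A=(a_{g,k})_{g,k\in G}$ is $G$-invariant if $a_{gl,kl}=a_{g,k}$ for all $g,k,l\in G$ (written additively for $G=R\times R$). A $\mathrm{BH}(G,h)$ matrix is a $G$-invariant $|G|\times |G|$ matrix $H$ all of whose entries are complex $h$th roots of unity and which satisfies $HH^*=|G|I_{|G|}$, where $H^*$ is the conjugate transpose and $I_{|G|}$ the identity matrix. *)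

theory Defs
  imports Complex_Main "HOL-Computational_Algebra.Primes" "HOL-Algebra.Algebra"
begin

text \<open>
  A matrix indexed by a finite group \<open>G\<close> is a function \<open>'g \<Rightarrow> 'g \<Rightarrow> complex\<close>; only its values on
  \<open>carrier G \<times> carrier G\<close> matter.
\<close>

definition group_invariant :: "('g, 'm) monoid_scheme \<Rightarrow> ('g \<Rightarrow> 'g \<Rightarrow> complex) \<Rightarrow> bool" where
  "group_invariant G A \<longleftrightarrow>
     (\<forall>g\<in>carrier G. \<forall>k\<in>carrier G. \<forall>l\<in>carrier G. A (g \<otimes>\<^bsub>G\<^esub> l) (k \<otimes>\<^bsub>G\<^esub> l) = A g k)"

text \<open>The last conjunct is the equation \<open>H H\<^sup>* = |G| I\<close>, written entry by entry.\<close>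

definition BH_matrix :: "('g, 'm) monoid_scheme \<Rightarrow> nat \<Rightarrow> ('g \<Rightarrow> 'g \<Rightarrow> complex) \<Rightarrow> bool" where
  "BH_matrix G h H \<longleftrightarrow>
     group_invariant G H \<and>
     (\<forall>g\<in>carrier G. \<forall>k\<in>carrier G. H g k ^ h = 1) \<and>
     (\<forall>g\<in>carrier G. \<forall>k\<in>carrier G.
        (\<Sum>l\<in>carrier G. H g l * cnj (H k l)) = (if g = k then of_nat (Coset.order G) else 0))"

text \<open>Local rings are commutative, as usual.\<close>

definition local_ring_with :: "('a, 'm) ring_scheme \<Rightarrow> 'a set \<Rightarrow> bool" where
  "local_ring_with R I \<longleftrightarrow>
     cring R \<and> maximalideal I R \<and> (\<forall>J. maximalideal J R \<longrightarrow> J = I)"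

end

theory Submission
  imports Defs
begin

text \<open>
  Write \<open>P j\<close> for \<open>\<pi>\<^sup>j R\<close> and \<open>q = p\<^sup>d\<close>. It suffices to find a function \<open>f\<close> on \<open>R \<times> R\<close> with values in the
  \<open>h\<close>th roots of unity whose autocorrelation vanishes off the origin. By induction on \<open>j\<close>, in steps
  of two, such an \<open>f\<close> is built modulo \<open>P j\<close>.

  The hypothesis on \<open>h\<close> gives a vanishing sum of \<open>q\<close> roots of unity, and hence \<open>\<phi>\<close> on \<open>R\<close>, defined modulo
  \<open>P j\<close>, whose sum over every coset of \<open>P (j - 1)\<close> is zero. Put \<open>f (x, y) = \<phi> (y / x)\<close> if \<open>x\<close> is a unit,
  \<open>f (x, y) = \<phi> (x / y)\<close> if only \<open>y\<close> is, and \<open>f (\<pi> x, \<pi> y) = g (x, y)\<close> with \<open>g\<close> the function for \<open>j - 2\<close>;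
  for \<open>j \<le> 1\<close> put \<open>f = 1\<close> wherever \<open>\<phi>\<close> is not used.
  Outside \<open>P 1 \<times> P 1\<close> this is a combination of indicators of the lines \<open>y = t x\<close> and \<open>x = s y\<close> with
  \<open>s \<in> P 1\<close>. The sums of \<open>\<phi>\<close> cancel all contributions of pairs of lines except those of
  two lines that agree modulo \<open>P (j - 1)\<close>; what they leave on \<open>P (j - 1) \<times> P (j - 1)\<close> is
  exactly compensated by the autocorrelation of \<open>g\<close>.
\<close>

section \<open>Finite chain rings and the ideals generated by powers of \<open>\<pi>\<close>\<close>

locale finite_chain_ring = cring R for R (structure) +
  fixes \<pi> :: 'a and n q :: nat
  assumes finite_carrier: "finite (carrier R)"
    and pi_closed [simp]: "\<pi> \<in> carrier R"
    and n_pos: "n > 0"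
    and pi_pow_n: "\<pi> [^] n = \<zero>"
    and pi_pow_pred: "\<pi> [^] (n - 1) \<noteq> \<zero>"
    and unit_or_multiple: "x \<in> carrier R \<Longrightarrow> x \<in> Units R \<or> (\<exists>y\<in>carrier R. x = \<pi> \<otimes> y)"
    and card_carrier: "card (carrier R) = q ^ n"
begin

definition P :: "nat \<Rightarrow> 'a set" where
  "P i = (\<lambda>x. \<pi> [^] i \<otimes> x) ` carrier R"

lemma P_I: "x \<in> carrier R \<Longrightarrow> \<pi> [^] i \<otimes> x \<in> P i"
  by (auto simp: P_def)

lemma P_closed: "x \<in> P i \<Longrightarrow> x \<in> carrier R"
  by (auto simp: P_def)

lemma P_0 [simp]: "P 0 = carrier R"
  by (auto simp: P_def)

lemma P_n [simp]: "P n = {\<zero>}"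
  by (auto simp: P_def pi_pow_n image_iff)

lemma P_finite [simp]: "finite (P i)"
  by (simp add: P_def finite_carrier)

lemma P_zero [simp]: "\<zero> \<in> P i"
  unfolding P_def by (rule image_eqI[of _ _ \<zero>]) auto

lemma P_add: "x \<in> P i \<Longrightarrow> y \<in> P i \<Longrightarrow> x \<oplus> y \<in> P i"
  unfolding P_def by (auto simp: r_distr[symmetric])

lemma P_mult: "a \<in> carrier R \<Longrightarrow> x \<in> P i \<Longrightarrow> a \<otimes> x \<in> P i"
  unfolding P_def by (auto simp: m_lcomm[of a])

lemma P_minus: "x \<in> P i \<Longrightarrow> \<ominus> x \<in> P i"
  using P_mult[of "\<ominus> \<one>" x i] P_closed[of x i] by (simp add: l_minus)

lemma P_diff: "x \<in> P i \<Longrightarrow> y \<in> P i \<Longrightarrow> x \<ominus> y \<in> P i"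
  by (simp add: a_minus_def P_add P_minus)

lemma P_mono: "i \<le> k \<Longrightarrow> P k \<subseteq> P i"
  unfolding P_def
  by (auto simp: nat_pow_mult[symmetric] m_assoc dest!: le_Suc_ex)

lemma P_add_iff: "s \<in> P i \<Longrightarrow> b \<in> carrier R \<Longrightarrow> b \<oplus> s \<in> P i \<longleftrightarrow> b \<in> P i"
proof
  assume s: "s \<in> P i" and b: "b \<in> carrier R" and "b \<oplus> s \<in> P i"
  then have "(b \<oplus> s) \<ominus> s \<in> P i" by (rule_tac P_diff)
  moreover have "(b \<oplus> s) \<ominus> s = b" using b P_closed[OF s] by algebra
  ultimately show "b \<in> P i" by simp
qed (simp add: P_add)

lemma P_unit_iff: "u \<in> Units R \<Longrightarrow> x \<in> carrier R \<Longrightarrow> u \<otimes> x \<in> P i \<longleftrightarrow> x \<in> P i"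
proof
  assume u: "u \<in> Units R" and x: "x \<in> carrier R" and "u \<otimes> x \<in> P i"
  then have "inv u \<otimes> (u \<otimes> x) \<in> P i" using P_mult[of "inv u" "u \<otimes> x" i] by simp
  moreover have "inv u \<otimes> (u \<otimes> x) = x" using u x by (simp add: m_assoc[symmetric] Units_closed)
  ultimately show "x \<in> P i" by simp
qed (simp add: P_mult Units_closed)

lemma pi_pow_nonzero: "k < n \<Longrightarrow> \<pi> [^] k \<noteq> \<zero>"
proof
  assume k: "k < n" and "\<pi> [^] k = \<zero>"
  then have "\<pi> [^] k \<otimes> \<pi> [^] (n - 1 - k) = \<zero>" by simp
  then show False using k pi_pow_pred by (simp add: nat_pow_mult)
qed

text \<open>If \<open>\<pi> [^] k\<close> were a multiple of \<open>\<pi> [^] j\<close> with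
  \<open>k < j\<close>, multiplying by \<open>\<pi> [^] (n - j)\<close> would give
  \<open>\<pi> [^] (n - j + k) = \<zero>\<close>, although this exponent is below
  \<open>n\<close>.\<close>

lemma pi_pow_mem_iff: "j \<le> n \<Longrightarrow> \<pi> [^] k \<in> P j \<longleftrightarrow> j \<le> k"
proof
  assume j: "j \<le> n" and "\<pi> [^] k \<in> P j"
  then obtain y where y: "y \<in> carrier R" "\<pi> [^] k = \<pi> [^] j \<otimes> y" by (auto simp: P_def)
  show "j \<le> k"
  proof (rule ccontr)
    assume kj: "\<not> j \<le> k"
    have "\<pi> [^] (n - j + k) = \<pi> [^] (n - j) \<otimes> \<pi> [^] k" by (simp add: nat_pow_mult)
    also have "\<dots> = \<pi> [^] (n - j) \<otimes> \<pi> [^] j \<otimes> y" using y by (simp add: m_assoc)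
    also have "\<dots> = \<zero>" using y j by (simp add: nat_pow_mult pi_pow_n)
    finally show False using pi_pow_nonzero[of "n - j + k"] kj j by linarith
  qed
next
  assume "j \<le> k"
  then show "\<pi> [^] k \<in> P j" using P_mono[of j k] P_I[of \<one> k] by auto
qed

lemma Units_iff: "x \<in> carrier R \<Longrightarrow> x \<in> Units R \<longleftrightarrow> x \<notin> P 1"
proof
  assume x: "x \<in> carrier R" and u: "x \<in> Units R"
  show "x \<notin> P 1"
  proof
    assume "x \<in> P 1"
    then have "\<one> \<in> P 1" using P_mult[of "inv x" x 1] u by simp
    then show False using pi_pow_mem_iff[of 1 0] n_pos by simp
  qed
qed (use unit_or_multiple[of x] in \<open>auto simp: P_def\<close>)

lemma Units_add: "u \<in> Units R \<Longrightarrow> x \<in> P 1 \<Longrightarrow> u \<oplus> x \<in> Units R"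
  using Units_iff[of u] Units_iff[of "u \<oplus> x"] P_add_iff[of x 1 u] P_closed[of x 1]
  by (auto simp: Units_closed)

text \<open>Take the largest \<open>k \<le> n\<close> with \<open>x \<in> P k\<close>. A cofactor
  that is not a unit would be divisible by \<open>\<pi>\<close>, against maximality. The exponent
  \<open>k\<close> serves as a valuation below.\<close>

lemma pi_power_unit_cases:
  assumes "x \<in> carrier R"
  obtains "x = \<zero>" | k u where "k < n" "u \<in> Units R" "x = \<pi> [^] k \<otimes> u"
proof (cases "x = \<zero>")
  case False
  define k where "k = Max {k. k \<le> n \<and> x \<in> P k}"
  have "k \<in> {k. k \<le> n \<and> x \<in> P k}" unfolding k_def
    by (rule Max_in) (use assms in \<open>auto intro: exI[of _ 0]\<close>)
  then have k: "k \<le> n" "x \<in> P k" by auto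
  with False have kn: "k < n" by (metis P_n le_neq_implies_less singletonD)
  have "x \<notin> P (Suc k)"
  proof
    assume "x \<in> P (Suc k)"
    then have "Suc k \<le> k" unfolding k_def
      by (rule_tac Max_ge) (use kn k_def in auto)
    then show False by simp
  qed
  obtain y where y: "y \<in> carrier R" "x = \<pi> [^] k \<otimes> y" using k by (auto simp: P_def)
  have "y \<in> Units R"
  proof (rule ccontr)
    assume "y \<notin> Units R"
    with y unit_or_multiple obtain z where "z \<in> carrier R" "y = \<pi> \<otimes> z" by blast
    then have "x = \<pi> [^] Suc k \<otimes> z" using y by (simp add: m_assoc)
    with \<open>z \<in> carrier R\<close> \<open>x \<notin> P (Suc k)\<close> show False using P_I by metis
  qed
  with kn y that(2) show thesis by blast
qed (use that(1) in blast)

text \<open>For \<open>x = \<pi> [^] k \<otimes> u\<close> with \<open>u\<close> a unit, both sides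
  say \<open>j \<le> i + k\<close>. If \<open>i \<ge> j\<close>, truncated subtraction gives
  \<open>P 0\<close>, the whole ring, as it should.\<close>

lemma pi_pow_mult_mem_iff:
  assumes "x \<in> carrier R" "j \<le> n"
  shows "\<pi> [^] i \<otimes> x \<in> P j \<longleftrightarrow> x \<in> P (j - i)"
  using assms(1)
proof (cases rule: pi_power_unit_cases)
  case (2 k u)
  have eq: "\<pi> [^] i \<otimes> x = u \<otimes> \<pi> [^] (i + k)" "x = u \<otimes> \<pi> [^] k"
    using 2 by (simp_all add: nat_pow_mult[symmetric] m_ac Units_closed)
  show ?thesis
    unfolding eq(1) using eq(2) 2 assms
    by (simp add: P_unit_iff pi_pow_mem_iff le_diff_conv add.commute)
qed simp

lemma sum_shift:
  assumes "a \<in> P i"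
  shows "(\<Sum>x\<in>P i. F (x \<oplus> a)) = (\<Sum>x\<in>P i. F x)"
proof (rule sum.reindex_bij_witness[of _ "\<lambda>x. x \<ominus> a" "\<lambda>x. x \<oplus> a"])
  fix x assume "x \<in> P i"
  with assms have c: "x \<in> carrier R" "a \<in> carrier R" by (auto intro: P_closed)
  show "x \<oplus> a \<ominus> a = x" "x \<ominus> a \<oplus> a = x" using c by algebra+
qed (use assms in \<open>auto intro: P_add P_diff\<close>)

lemma sum_shift_carrier:
  assumes "a \<in> carrier R"
  shows "(\<Sum>x\<in>carrier R. F (x \<oplus> a)) = (\<Sum>x\<in>carrier R. F x)"
  using sum_shift[of a 0 F] assms by simp

lemma sum_unit:
  assumes "u \<in> Units R"
  shows "(\<Sum>x\<in>carrier R. F (u \<otimes> x)) = (\<Sum>x\<in>carrier R. F x)"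
  by (rule sum.reindex_bij_witness[of _ "\<lambda>x. inv u \<otimes> x" "\<lambda>x. u \<otimes> x"])
     (use assms in \<open>auto simp: m_assoc[symmetric] Units_closed\<close>)

text \<open>The fibre is a coset of the annihilator of \<open>\<pi> [^] i\<close>, and this
  annihilator is \<open>P (n - i)\<close>.\<close>

lemma card_fibre:
  assumes "i \<le> n" "y \<in> P i"
  shows "card {x \<in> carrier R. \<pi> [^] i \<otimes> x = y} = card (P (n - i))"
proof -
  obtain z where z: "z \<in> carrier R" "y = \<pi> [^] i \<otimes> z" using assms by (auto simp: P_def)
  have "bij_betw (\<lambda>s. s \<oplus> z) (P (n - i)) {x \<in> carrier R. \<pi> [^] i \<otimes> x = y}"
  proof (rule bij_betwI[where g = "\<lambda>x. x \<ominus> z"])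
    have ker: "s \<in> P (n - i) \<longleftrightarrow> \<pi> [^] i \<otimes> s = \<zero>" if "s \<in> carrier R" for s
      using pi_pow_mult_mem_iff[of s n i] that by simp
    show "(\<lambda>s. s \<oplus> z) \<in> P (n - i) \<rightarrow> {x \<in> carrier R. \<pi> [^] i \<otimes> x = y}"
      using z ker P_closed by (force simp: r_distr)
    show "(\<lambda>x. x \<ominus> z) \<in> {x \<in> carrier R. \<pi> [^] i \<otimes> x = y} \<rightarrow> P (n - i)"
    proof
      fix x assume "x \<in> {x \<in> carrier R. \<pi> [^] i \<otimes> x = y}"
      then have x: "x \<in> carrier R" "\<pi> [^] i \<otimes> x = y" by auto
      have "\<pi> [^] i \<otimes> (x \<ominus> z) = \<pi> [^] i \<otimes> x \<ominus> \<pi> [^] i \<otimes> z"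
        using x(1) z(1) by (simp add: a_minus_def r_distr r_minus)
      also have "\<dots> = \<zero>" using x z by (simp add: a_minus_def r_neg)
      finally show "x \<ominus> z \<in> P (n - i)" using ker[of "x \<ominus> z"] x z by simp
    qed
  next
    fix s assume "s \<in> P (n - i)"
    then have "s \<in> carrier R" by (rule P_closed)
    with z(1) show "s \<oplus> z \<ominus> z = s" by algebra
  next
    fix s assume "s \<in> {x \<in> carrier R. \<pi> [^] i \<otimes> x = y}"
    then have "s \<in> carrier R" by auto
    with z(1) show "s \<ominus> z \<oplus> z = s" by algebra
  qed
  then show ?thesis by (metis bij_betw_same_card)
qed

lemma sum_pi_pow_mult:
  fixes F :: "'a \<Rightarrow> complex"
  assumes "i \<le> n"
  shows "(\<Sum>x\<in>carrier R. F (\<pi> [^] i \<otimes> x)) = of_nat (card (P (n - i))) * (\<Sum>y\<in>P i. F y)"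
proof -
  have "(\<Sum>x\<in>carrier R. F (\<pi> [^] i \<otimes> x)) =
      (\<Sum>y\<in>P i. \<Sum>x | x \<in> carrier R \<and> \<pi> [^] i \<otimes> x = y. F (\<pi> [^] i \<otimes> x))"
    by (rule sum.group[symmetric]) (auto simp: finite_carrier P_I)
  also have "\<dots> = (\<Sum>y\<in>P i. of_nat (card (P (n - i))) * F y)"
    using card_fibre[OF assms] by (intro sum.cong) auto
  finally show ?thesis by (simp add: sum_distrib_left)
qed

text \<open>Multiplication by \<open>\<pi>\<close> maps the ring onto \<open>P 1\<close> with all
  fibres of size \<open>card (P (n - 1))\<close>. The preimage of \<open>P (Suc i)\<close> is
  \<open>P i\<close>; counting it by fibres gives the identity.\<close>

lemma card_P_Suc:
  assumes "i < n"
  shows "card (P i) = card (P (n - 1)) * card (P (Suc i))"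
proof -
  have "(\<Sum>x\<in>carrier R. of_bool (\<pi> [^] (1::nat) \<otimes> x \<in> P (Suc i))) = (\<Sum>x\<in>carrier R. of_bool (x \<in> P i) :: complex)"
    using pi_pow_mult_mem_iff[of _ "Suc i" 1] assms by (intro sum.cong) auto
  also have "\<dots> = of_nat (card (P i))"
    using P_closed by (simp add: sum.If_cases finite_carrier Int_absorb1 subsetI)
  finally have "of_nat (card (P i)) = of_nat (card (P (n - 1))) * (\<Sum>x\<in>P 1. of_bool (x \<in> P (Suc i)) :: complex)"
    using sum_pi_pow_mult[of 1 "\<lambda>x. of_bool (x \<in> P (Suc i))"] n_pos by simp
  also have "(\<Sum>x\<in>P 1. of_bool (x \<in> P (Suc i)) :: complex) = of_nat (card (P (Suc i)))"
    using P_mono[of 1 "Suc i"] by (simp add: Int_absorb1)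
  finally show ?thesis by (metis of_nat_eq_iff of_nat_mult)
qed

text \<open>Iteration gives \<open>card (P (n - k)) = card (P (n - 1)) ^ k\<close>. Comparing the
  case \<open>k = n\<close> with \<open>card_carrier\<close> identifies \<open>q\<close> as
  \<open>card (P (n - 1))\<close>.\<close>

lemma card_P:
  assumes "i \<le> n"
  shows "card (P i) = q ^ (n - i)"
proof -
  have pow: "card (P (n - k)) = card (P (n - 1)) ^ k" if "k \<le> n" for k
    using that
  proof (induction k)
    case (Suc k)
    then have "Suc (n - Suc k) = n - k" by simp
    then show ?case using Suc card_P_Suc[of "n - Suc k"] by simp
  qed simp
  have "q ^ n = card (P (n - 1)) ^ n" using pow[of n] card_carrier by simp
  then have "q = card (P (n - 1))" using n_pos by (simp add: power_eq_iff_eq_base)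
  then show ?thesis using pow[of "n - i"] assms by simp
qed

lemma q_pos: "q > 0"
  using card_carrier finite_carrier n_pos by (metis card_gt_0_iff carrier_not_empty power_eq_0_iff gr0I)

section \<open>Indicators of ideals and correlations on pairs\<close>

definition D :: "nat \<Rightarrow> 'a \<Rightarrow> complex" where
  "D i b = of_bool (b \<in> P i)"

text \<open>This is the periodic cross-correlation on the additive group of pairs, at the shift
  \<open>(w1, w2)\<close>.\<close>

definition corr :: "('a \<Rightarrow> 'a \<Rightarrow> complex) \<Rightarrow> ('a \<Rightarrow> 'a \<Rightarrow> complex) \<Rightarrow> 'a \<Rightarrow> 'a \<Rightarrow> complex" where
  "corr F G w1 w2 = (\<Sum>x\<in>carrier R. \<Sum>y\<in>carrier R. F (x \<oplus> w1) (y \<oplus> w2) * cnj (G x y))"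

lemma sum_swap_pairs:
  "(\<Sum>x\<in>A. \<Sum>y\<in>B. \<Sum>t\<in>S. \<Sum>s\<in>T. f x y t s) = (\<Sum>t\<in>S. \<Sum>s\<in>T. \<Sum>x\<in>A. \<Sum>y\<in>B. f x y t s)"
proof -
  have "(\<Sum>x\<in>A. \<Sum>y\<in>B. \<Sum>t\<in>S. \<Sum>s\<in>T. f x y t s) = (\<Sum>x\<in>A. \<Sum>t\<in>S. \<Sum>y\<in>B. \<Sum>s\<in>T. f x y t s)"
    by (intro sum.cong refl sum.swap)
  also have "\<dots> = (\<Sum>t\<in>S. \<Sum>x\<in>A. \<Sum>y\<in>B. \<Sum>s\<in>T. f x y t s)" by (rule sum.swap)
  also have "\<dots> = (\<Sum>t\<in>S. \<Sum>x\<in>A. \<Sum>s\<in>T. \<Sum>y\<in>B. f x y t s)"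
    by (intro sum.cong refl sum.swap)
  also have "\<dots> = (\<Sum>t\<in>S. \<Sum>s\<in>T. \<Sum>x\<in>A. \<Sum>y\<in>B. f x y t s)"
    by (intro sum.cong refl sum.swap)
  finally show ?thesis .
qed

text \<open>Correlation is sesquilinear. With line indicators for \<open>K\<close> and
  \<open>L\<close>, the correlation of two weighted sums reduces to counting common points of one
  shifted line and another line; \<open>c\<close> and \<open>d\<close> will be
  \<open>card (P j)\<close>.\<close>

lemma corr_superposition:
  "corr (\<lambda>x y. (\<Sum>t\<in>A. f t * K t x y) / c) (\<lambda>x y. (\<Sum>s\<in>B. g s * L s x y) / d) w1 w2 =
    (\<Sum>t\<in>A. \<Sum>s\<in>B. f t * cnj (g s) *
      (\<Sum>x\<in>carrier R. \<Sum>y\<in>carrier R. K t (x \<oplus> w1) (y \<oplus> w2) * cnj (L s x y))) / (c * cnj d)"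
proof -
  have prod: "(\<Sum>t\<in>A. a t) / c * cnj ((\<Sum>s\<in>B. b s) / d) = (\<Sum>t\<in>A. \<Sum>s\<in>B. a t * cnj (b s) / (c * cnj d))" for a b
  proof -
    have "(\<Sum>t\<in>A. a t) / c * cnj ((\<Sum>s\<in>B. b s) / d) = ((\<Sum>t\<in>A. a t) * (\<Sum>s\<in>B. cnj (b s))) / (c * cnj d)"
      by simp
    then show ?thesis by (simp only: sum_product sum_divide_distrib)
  qed
  have "corr (\<lambda>x y. (\<Sum>t\<in>A. f t * K t x y) / c) (\<lambda>x y. (\<Sum>s\<in>B. g s * L s x y) / d) w1 w2 =
     (\<Sum>t\<in>A. \<Sum>s\<in>B. \<Sum>x\<in>carrier R. \<Sum>y\<in>carrier R.
       (f t * K t (x \<oplus> w1) (y \<oplus> w2)) * cnj (g s * L s x y) / (c * cnj d))"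
    unfolding corr_def prod by (rule sum_swap_pairs)
  also have "\<dots> = (\<Sum>t\<in>A. \<Sum>s\<in>B. \<Sum>x\<in>carrier R. \<Sum>y\<in>carrier R.
       (f t * cnj (g s) * (K t (x \<oplus> w1) (y \<oplus> w2) * cnj (L s x y))) / (c * cnj d))"
    by (simp add: mult_ac)
  finally show ?thesis by (simp only: sum_distrib_left sum_divide_distrib)
qed

lemma cnj_D [simp]: "cnj (D i b) = D i b"
  by (simp add: D_def)

lemma D_add: "s \<in> P i \<Longrightarrow> b \<in> carrier R \<Longrightarrow> D i (b \<oplus> s) = D i b"
  by (simp add: D_def P_add_iff)

lemma D_unit: "u \<in> Units R \<Longrightarrow> b \<in> carrier R \<Longrightarrow> D i (u \<otimes> b) = D i b"
  by (simp add: D_def P_unit_iff)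

lemma P_mult_P: "x \<in> P i \<Longrightarrow> y \<in> P k \<Longrightarrow> x \<otimes> y \<in> P (i + k)"
proof -
  assume "x \<in> P i" "y \<in> P k"
  then obtain a b where ab: "a \<in> carrier R" "b \<in> carrier R" "x = \<pi> [^] i \<otimes> a" "y = \<pi> [^] k \<otimes> b"
    by (auto simp: P_def)
  then have "x \<otimes> y = \<pi> [^] (i + k) \<otimes> (a \<otimes> b)"
    by (simp add: nat_pow_mult[symmetric] m_ac)
  then show ?thesis using ab by (simp add: P_I)
qed

lemma sum_D_mult:
  assumes "i \<le> k"
  shows "(\<Sum>x\<in>P i. D k x * F x) = (\<Sum>x\<in>P k. F x)"
proof -
  have "(\<Sum>x\<in>P i. D k x * F x) = (\<Sum>x\<in>P k. D k x * F x)"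
    using P_mono[OF assms] by (intro sum.mono_neutral_right) (auto simp: D_def)
  also have "\<dots> = (\<Sum>x\<in>P k. F x)"
    by (intro sum.cong) (auto simp: D_def)
  finally show ?thesis .
qed

lemma sum_D: "i \<le> k \<Longrightarrow> (\<Sum>x\<in>P i. D k x) = of_nat (card (P k))"
  using sum_D_mult[of i k "\<lambda>_. 1"] by simp

lemma card_P_nonzero: "card (P i) \<noteq> 0"
  using P_zero[of i] by (metis P_finite card_0_eq empty_iff)

text \<open>Averaging over all translates by elements of \<open>P k\<close> replaces a choice of
  representatives for the cosets of \<open>P k\<close> in \<open>P i\<close>.\<close>

lemma sum_zero_by_cosets:
  fixes F :: "'a \<Rightarrow> complex"
  assumes "i \<le> k" and F: "\<And>a. a \<in> P i \<Longrightarrow> (\<Sum>s\<in>P k. F (a \<oplus> s)) = 0"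
  shows "(\<Sum>a\<in>P i. F a) = 0"
proof -
  have "of_nat (card (P k)) * (\<Sum>a\<in>P i. F a) = (\<Sum>s\<in>P k. \<Sum>a\<in>P i. F a)"
    by simp
  also have "\<dots> = (\<Sum>s\<in>P k. \<Sum>a\<in>P i. F (a \<oplus> s))"
    using P_mono[OF assms(1)] by (intro sum.cong refl sum_shift[symmetric]) auto
  also have "\<dots> = (\<Sum>a\<in>P i. \<Sum>s\<in>P k. F (a \<oplus> s))"
    by (rule sum.swap)
  also have "\<dots> = 0" using F by simp
  finally show ?thesis using card_P_nonzero[of k] by simp
qed

lemma P_pred_mult_P_1: "j > 0 \<Longrightarrow> s \<in> P (j - 1) \<Longrightarrow> x \<in> P 1 \<Longrightarrow> s \<otimes> x \<in> P j"
  using P_mult_P[of s "j - 1" x 1] by simp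

lemma card_P_pred: "0 < j \<Longrightarrow> j \<le> n \<Longrightarrow> card (P (j - 1)) = q * card (P j)"
  by (simp add: card_P Suc_diff_le flip: power_Suc)

end

section \<open>Balanced functions and superpositions of lines\<close>

locale balanced_function = finite_chain_ring +
  fixes j :: nat and \<phi> :: "'a \<Rightarrow> complex"
  assumes j_pos: "0 < j" and j_le: "j \<le> n"
    and phi_add: "t \<in> carrier R \<Longrightarrow> s \<in> P j \<Longrightarrow> \<phi> (t \<oplus> s) = \<phi> t"
    and phi_sum: "t \<in> carrier R \<Longrightarrow> (\<Sum>s\<in>P (j - 1). \<phi> (t \<oplus> s)) = 0"
    and phi_unimodular: "t \<in> carrier R \<Longrightarrow> \<phi> t * cnj (\<phi> t) = 1"
begin

text \<open>The number of \<open>x\<close> at which two affine functions with difference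
  \<open>a \<otimes> x \<oplus> b\<close> agree modulo \<open>P j\<close>. In
  \<open>line_pair\<close>, \<open>a\<close> is a difference of slopes and \<open>b\<close> comes
  from the shift.\<close>

definition N :: "'a \<Rightarrow> 'a \<Rightarrow> complex" where
  "N a b = (\<Sum>x\<in>carrier R. D j (a \<otimes> x \<oplus> b))"

lemma P_j_pred: "x \<in> P j \<Longrightarrow> x \<in> P (j - 1)"
  using P_mono[of "j - 1" j] by auto

lemma N_mult_unit:
  assumes "u \<in> Units R" "a \<in> carrier R" "b \<in> carrier R"
  shows "N (a \<otimes> u) b = N a b"
proof -
  have "N (a \<otimes> u) b = (\<Sum>x\<in>carrier R. D j (a \<otimes> (u \<otimes> x) \<oplus> b))"
    unfolding N_def using assms by (intro sum.cong) (auto simp: m_assoc Units_closed)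
  then show ?thesis unfolding N_def using sum_unit[OF assms(1)] by simp
qed

text \<open>Such an \<open>a\<close> is \<open>\<pi> [^] k\<close> times a unit with
  \<open>k < j - 1\<close>, hence divides every \<open>s \<in> P (j - 1)\<close> with a quotient
  \<open>e \<in> P 1\<close>. So \<open>a \<oplus> s\<close> is \<open>a\<close> times the unit
  \<open>\<one> \<oplus> e\<close>, and \<open>N\<close> ignores unit factors of
  \<open>a\<close>.\<close>

lemma N_add:
  assumes "a \<in> carrier R" "a \<notin> P (j - 1)" "s \<in> P (j - 1)" "b \<in> carrier R"
  shows "N (a \<oplus> s) b = N a b"
  using assms(1)
proof (cases rule: pi_power_unit_cases)
  case (2 k u)
  have k: "k < j - 1"
  proof (rule ccontr)
    assume "\<not> k < j - 1"
    then have "a \<in> P (j - 1)" using 2 P_I[of u k] P_mono[of "j - 1" k] by (auto simp: Units_closed)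
    then show False using assms by simp
  qed
  obtain z where z: "z \<in> carrier R" "s = \<pi> [^] (j - 1) \<otimes> z" using assms by (auto simp: P_def)
  define e where "e = \<pi> [^] (j - 1 - k) \<otimes> (inv u \<otimes> z)"
  have "e \<in> P 1"
    using P_I[of "inv u \<otimes> z" "j - 1 - k"] P_mono[of 1 "j - 1 - k"] k z 2 unfolding e_def by (auto simp: subset_iff)
  then have e: "e \<in> carrier R" "\<one> \<oplus> e \<in> Units R" using Units_add[of \<one> e] P_closed by auto
  have "a \<otimes> e = (\<pi> [^] k \<otimes> \<pi> [^] (j - 1 - k)) \<otimes> ((u \<otimes> inv u) \<otimes> z)"
    using 2 z unfolding e_def by (simp add: m_ac Units_closed del: Units_r_inv)
  also have "\<dots> = s" using 2 z k by (simp add: nat_pow_mult)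
  finally have "a \<oplus> s = a \<otimes> (\<one> \<oplus> e)" using assms(1) e(1) by (simp add: r_distr)
  then show ?thesis using N_mult_unit[OF e(2) assms(1,4)] by simp
qed (use assms in simp)

text \<open>Removing a unit factor reduces to \<open>a = \<pi> [^] (j - 1)\<close>. The condition
  then forces \<open>b = \<pi> [^] (j - 1) \<otimes> z\<close> and becomes
  \<open>x \<oplus> z \<in> P 1\<close>, which has \<open>q ^ (n - 1)\<close> solutions.\<close>

lemma N_boundary:
  assumes "a \<in> P (j - 1)" "a \<notin> P j" "b \<in> carrier R"
  shows "N a b = of_nat q ^ (n - 1) * D (j - 1) b"
  using P_closed[OF assms(1)]
proof (cases rule: pi_power_unit_cases)
  case (2 k u)
  have "\<not> j \<le> k"
    using assms(2) 2 P_I[of u k] P_mono[of j k] by (auto simp: Units_closed)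
  moreover have "j - 1 \<le> k"
    using assms(1) 2 pi_pow_mem_iff[of "j - 1" k] P_unit_iff[of u "\<pi> [^] k" "j - 1"] j_le
    by (simp add: m_comm[of "\<pi> [^] k"] Units_closed)
  ultimately have k: "k = j - 1" using j_pos by simp
  have "N a b = N (\<pi> [^] (j - 1)) b"
    using N_mult_unit[of u "\<pi> [^] (j - 1)" b] 2 k assms by simp
  also have "\<dots> = of_nat q ^ (n - 1) * D (j - 1) b"
  proof (cases "b \<in> P (j - 1)")
    case True
    then obtain z where z: "z \<in> carrier R" "b = \<pi> [^] (j - 1) \<otimes> z" by (auto simp: P_def)
    have "D j (\<pi> [^] (j - 1) \<otimes> x \<oplus> b) = D 1 (x \<oplus> z)" if "x \<in> carrier R" for x
      using that z j_pos j_le pi_pow_mult_mem_iff[of "x \<oplus> z" j "j - 1"]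
      by (simp add: D_def r_distr[symmetric])
    then have "N (\<pi> [^] (j - 1)) b = (\<Sum>x\<in>carrier R. D 1 (x \<oplus> z))"
      by (simp add: N_def)
    also have "\<dots> = (\<Sum>x\<in>P 0. D 1 x)" using sum_shift_carrier[OF z(1)] by simp
    also have "\<dots> = of_nat q ^ (n - 1)" using sum_D[of 0 1] n_pos card_P[of 1] by simp
    finally show ?thesis using True by (simp add: D_def)
  next
    case False
    have "\<pi> [^] (j - 1) \<otimes> x \<oplus> b \<notin> P j" if "x \<in> carrier R" for x
      using False P_add_iff[of "\<pi> [^] (j - 1) \<otimes> x" "j - 1" b] that assms P_j_pred P_I
      by (metis P_closed a_comm)
    then show ?thesis using False by (simp add: N_def D_def)
  qed
  finally show ?thesis .
qed (use assms in simp)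

lemma N_inside: "a \<in> P j \<Longrightarrow> b \<in> carrier R \<Longrightarrow> N a b = of_nat q ^ n * D j b"
proof -
  assume a: "a \<in> P j" and b: "b \<in> carrier R"
  have "D j (a \<otimes> x \<oplus> b) = D j b" if "x \<in> carrier R" for x
    using D_add[of "x \<otimes> a" j b] P_mult[of x a j] a b that P_closed[OF a]
    by (simp add: m_comm a_comm)
  then show ?thesis by (simp add: N_def card_carrier)
qed

lemma sum_phi_N:
  assumes "i \<le> j - 1" "t \<in> carrier R" "b \<in> carrier R"
  shows "(\<Sum>a\<in>P i. cnj (\<phi> (t \<oplus> a)) * N a b) =
    of_nat (card (P j)) * cnj (\<phi> t) * (of_nat q ^ n * D j b - of_nat q ^ (n - 1) * D (j - 1) b)"
proof -
  \<comment> \<open>Replacing \<open>N\<close> on \<open>P j\<close> by its value on the rest of \<open>P (j - 1)\<close> makes it invariant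
    under \<open>P (j - 1)\<close>, so that it is orthogonal to \<open>\<phi>\<close>.\<close>
  define N' where "N' a = (if a \<in> P j then of_nat q ^ (n - 1) * D (j - 1) b else N a b)" for a
  have N'_pred: "N' a = of_nat q ^ (n - 1) * D (j - 1) b" if "a \<in> P (j - 1)" for a
    using N_boundary[of a b] that assms by (simp add: N'_def)
  have inv: "N' (a \<oplus> s) = N' a" if a: "a \<in> carrier R" and s: "s \<in> P (j - 1)" for a s
  proof (cases "a \<in> P (j - 1)")
    case True
    then show ?thesis using N'_pred P_add s by simp
  next
    case False
    then have "a \<oplus> s \<notin> P (j - 1)" using P_add_iff s a by simp
    then show ?thesis using False P_j_pred N_add[OF a False s assms(3)] by (auto simp: N'_def)
  qed
  have "(\<Sum>a\<in>P i. cnj (\<phi> (t \<oplus> a)) * N' a) = 0"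
  proof (rule sum_zero_by_cosets[OF assms(1)])
    fix a assume "a \<in> P i"
    then have a: "a \<in> carrier R" by (rule P_closed)
    have "(\<Sum>s\<in>P (j - 1). cnj (\<phi> (t \<oplus> (a \<oplus> s))) * N' (a \<oplus> s)) =
        (\<Sum>s\<in>P (j - 1). cnj (\<phi> ((t \<oplus> a) \<oplus> s)) * N' a)"
      using a assms inv P_closed by (intro sum.cong refl) (simp add: a_assoc)
    also have "\<dots> = cnj (\<Sum>s\<in>P (j - 1). \<phi> ((t \<oplus> a) \<oplus> s)) * N' a"
      by (simp add: sum_distrib_right)
    also have "\<dots> = 0" using phi_sum[of "t \<oplus> a"] a assms by simp
    finally show "(\<Sum>s\<in>P (j - 1). cnj (\<phi> (t \<oplus> (a \<oplus> s))) * N' (a \<oplus> s)) = 0" .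
  qed
  then have "(\<Sum>a\<in>P i. cnj (\<phi> (t \<oplus> a)) * N a b) = (\<Sum>a\<in>P i. cnj (\<phi> (t \<oplus> a)) * (N a b - N' a))"
    by (simp add: right_diff_distrib sum_subtractf)
  \<comment> \<open>Only \<open>P j\<close> survives, since elsewhere \<open>N'\<close> equals
    \<open>N\<close>; and on \<open>P j\<close> the factor \<open>\<phi> (t \<oplus> a)\<close> is
    constantly \<open>\<phi> t\<close>.\<close>
  also have "\<dots> = (\<Sum>a\<in>P j. cnj (\<phi> (t \<oplus> a)) * (N a b - N' a))"
    using assms(1) P_mono[of i j] by (intro sum.mono_neutral_right) (auto simp: N'_def)
  also have "\<dots> = (\<Sum>a\<in>P j. cnj (\<phi> t) * (of_nat q ^ n * D j b - of_nat q ^ (n - 1) * D (j - 1) b))"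
    using assms phi_add N_inside by (intro sum.cong) (auto simp: N'_def)
  finally show ?thesis by simp
qed

text \<open>The weighted sum of the indicators of the lines \<open>y = t x\<close> modulo \<open>P j\<close>; dividing by \<open>card (P j)\<close>
  corrects for slopes that are congruent modulo \<open>P j\<close>.\<close>

definition lines :: "nat \<Rightarrow> 'a \<Rightarrow> 'a \<Rightarrow> complex" where
  "lines i x y = (\<Sum>t\<in>P i. \<phi> t * D j (y \<ominus> t \<otimes> x)) / of_nat (card (P j))"

text \<open>Substituting \<open>y \<oplus> t' \<otimes> x\<close> for \<open>y\<close> turns the
  second condition into \<open>y \<in> P j\<close>. For fixed \<open>x\<close>, either all these
  \<open>card (P j)\<close> values of \<open>y\<close> satisfy the first condition or none does,
  according to the condition counted by \<open>N\<close>.\<close>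

lemma line_pair:
  assumes "t \<in> carrier R" "t' \<in> carrier R" "w1 \<in> carrier R" "w2 \<in> carrier R"
  shows "(\<Sum>x\<in>carrier R. \<Sum>y\<in>carrier R. D j ((y \<oplus> w2) \<ominus> t \<otimes> (x \<oplus> w1)) * D j (y \<ominus> t' \<otimes> x))
    = of_nat (card (P j)) * N (t' \<ominus> t) (w2 \<ominus> t \<otimes> w1)"
proof -
  have "(\<Sum>y\<in>carrier R. D j ((y \<oplus> w2) \<ominus> t \<otimes> (x \<oplus> w1)) * D j (y \<ominus> t' \<otimes> x))
      = of_nat (card (P j)) * D j ((t' \<ominus> t) \<otimes> x \<oplus> (w2 \<ominus> t \<otimes> w1))" if x: "x \<in> carrier R" for x
  proof -
    let ?c = "(t' \<ominus> t) \<otimes> x \<oplus> (w2 \<ominus> t \<otimes> w1)"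
    have "(\<Sum>y\<in>carrier R. D j ((y \<oplus> w2) \<ominus> t \<otimes> (x \<oplus> w1)) * D j (y \<ominus> t' \<otimes> x))
        = (\<Sum>y\<in>carrier R. D j (((y \<oplus> t' \<otimes> x) \<oplus> w2) \<ominus> t \<otimes> (x \<oplus> w1)) * D j ((y \<oplus> t' \<otimes> x) \<ominus> t' \<otimes> x))"
      using x assms by (intro sum_shift_carrier[symmetric]) simp
    also have "\<dots> = (\<Sum>y\<in>P 0. D j y * D j (?c \<oplus> y))"
    proof (intro sum.cong)
      fix y assume "y \<in> P 0"
      then have y: "y \<in> carrier R" by simp
      have "((y \<oplus> t' \<otimes> x) \<oplus> w2) \<ominus> t \<otimes> (x \<oplus> w1) = ?c \<oplus> y" "(y \<oplus> t' \<otimes> x) \<ominus> t' \<otimes> x = y"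
        using x y assms by algebra+
      then show "D j (((y \<oplus> t' \<otimes> x) \<oplus> w2) \<ominus> t \<otimes> (x \<oplus> w1)) * D j ((y \<oplus> t' \<otimes> x) \<ominus> t' \<otimes> x)
          = D j y * D j (?c \<oplus> y)" by simp
    qed simp
    also have "\<dots> = (\<Sum>y\<in>P j. D j ?c)"
      unfolding sum_D_mult[OF le0] using x assms by (intro sum.cong refl D_add) auto
    finally show ?thesis by simp
  qed
  then show ?thesis by (simp add: N_def sum_distrib_left)
qed

text \<open>For a fixed slope \<open>t\<close>, the sum over \<open>t' = t \<oplus> a\<close> is an
  instance of \<open>sum_phi_N\<close>; the factor \<open>cnj (\<phi> t)\<close> that it leaves
  meets \<open>\<phi> t\<close> and gives 1. The powers of \<open>card (P j)\<close> cancel against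
  the normalisation in \<open>lines\<close>.\<close>

lemma corr_lines_self_sum:
  assumes "i \<le> j - 1" "w1 \<in> carrier R" "w2 \<in> carrier R"
  shows "corr (lines i) (lines i) w1 w2 =
    (\<Sum>t\<in>P i. of_nat q ^ n * D j (w2 \<ominus> t \<otimes> w1) - of_nat q ^ (n - 1) * D (j - 1) (w2 \<ominus> t \<otimes> w1))"
    (is "_ = (\<Sum>t\<in>P i. ?E t)")
proof -
  define c where "c = (of_nat (card (P j)) :: complex)"
  have c: "c \<noteq> 0" using card_P_nonzero by (simp add: c_def)
  have "corr (lines i) (lines i) w1 w2 =
      (\<Sum>t\<in>P i. \<Sum>t'\<in>P i. \<phi> t * cnj (\<phi> t') * (\<Sum>x\<in>carrier R. \<Sum>y\<in>carrier R.
      D j ((y \<oplus> w2) \<ominus> t \<otimes> (x \<oplus> w1)) * D j (y \<ominus> t' \<otimes> x))) / c\<^sup>2"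
    unfolding lines_def by (subst corr_superposition) (simp add: c_def power2_eq_square)
  also have "\<dots> = (\<Sum>t\<in>P i. \<Sum>t'\<in>P i. \<phi> t * cnj (\<phi> t') * (c * N (t' \<ominus> t) (w2 \<ominus> t \<otimes> w1))) / c\<^sup>2"
    using line_pair assms P_closed by (simp add: c_def)
  also have "\<dots> = (\<Sum>t\<in>P i. c\<^sup>2 * ?E t) / c\<^sup>2"
  proof (intro arg_cong[of _ _ "\<lambda>z. z / c\<^sup>2"] sum.cong refl)
    fix t assume t: "t \<in> P i"
    then have tc: "t \<in> carrier R" by (rule P_closed)
    have "(\<Sum>t'\<in>P i. cnj (\<phi> t') * N (t' \<ominus> t) (w2 \<ominus> t \<otimes> w1))
        = (\<Sum>a\<in>P i. cnj (\<phi> (a \<oplus> t)) * N ((a \<oplus> t) \<ominus> t) (w2 \<ominus> t \<otimes> w1))"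
      using t by (rule sum_shift[symmetric])
    also have "\<dots> = (\<Sum>a\<in>P i. cnj (\<phi> (t \<oplus> a)) * N a (w2 \<ominus> t \<otimes> w1))"
    proof (intro sum.cong refl)
      fix a assume "a \<in> P i"
      then have a: "a \<in> carrier R" by (rule P_closed)
      have "(a \<oplus> t) \<ominus> t = a" using a tc by algebra
      then show "cnj (\<phi> (a \<oplus> t)) * N ((a \<oplus> t) \<ominus> t) (w2 \<ominus> t \<otimes> w1) = cnj (\<phi> (t \<oplus> a)) * N a (w2 \<ominus> t \<otimes> w1)"
        using a tc by (simp add: a_comm)
    qed
    also have "\<dots> = c * cnj (\<phi> t) * ?E t"
      unfolding c_def using assms tc by (intro sum_phi_N) auto
    finally have S: "(\<Sum>t'\<in>P i. cnj (\<phi> t') * N (t' \<ominus> t) (w2 \<ominus> t \<otimes> w1)) = c * cnj (\<phi> t) * ?E t" .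
    have "(\<Sum>t'\<in>P i. \<phi> t * cnj (\<phi> t') * (c * N (t' \<ominus> t) (w2 \<ominus> t \<otimes> w1)))
        = c * \<phi> t * (\<Sum>t'\<in>P i. cnj (\<phi> t') * N (t' \<ominus> t) (w2 \<ominus> t \<otimes> w1))"
      by (simp add: sum_distrib_left mult_ac)
    also have "\<dots> = c\<^sup>2 * (\<phi> t * cnj (\<phi> t)) * ?E t"
      unfolding S by (simp add: power2_eq_square mult_ac)
    also have "\<dots> = c\<^sup>2 * ?E t" using phi_unimodular[OF tc] by simp
    finally show "(\<Sum>t'\<in>P i. \<phi> t * cnj (\<phi> t') * (c * N (t' \<ominus> t) (w2 \<ominus> t \<otimes> w1))) = c\<^sup>2 * ?E t" .
  qed
  also have "\<dots> = (\<Sum>t\<in>P i. ?E t)" using c by (simp add: sum_distrib_left[symmetric])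
  finally show ?thesis .
qed

lemma sum_D_coset:
  assumes "b \<in> carrier R"
  shows "(\<Sum>s\<in>P (j - 1). D j (b \<oplus> s)) = of_nat (card (P j)) * D (j - 1) b"
proof (cases "b \<in> P (j - 1)")
  case True
  have "(\<Sum>s\<in>P (j - 1). D j (b \<oplus> s)) = (\<Sum>s\<in>P (j - 1). D j (s \<oplus> b))"
    using assms P_closed by (intro sum.cong) (auto simp: a_comm)
  also have "\<dots> = (\<Sum>s\<in>P (j - 1). D j s)" by (rule sum_shift[OF True])
  also have "\<dots> = of_nat (card (P j))" by (rule sum_D) simp
  finally show ?thesis using True by (simp add: D_def)
next
  case False
  then have "b \<oplus> s \<notin> P j" if "s \<in> P (j - 1)" for s
    using that P_j_pred P_add_iff assms by blast
  then show ?thesis using False by (simp add: D_def)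
qed

text \<open>If \<open>w1 \<in> P (j - i)\<close>, every \<open>t \<otimes> w1\<close> lies in
  \<open>P j\<close> and the summand does not depend on \<open>t\<close>. Otherwise the distribution
  of the values \<open>w2 \<ominus> t \<otimes> w1\<close> modulo \<open>P j\<close> is invariant
  under translation by \<open>P (j - 1)\<close>, so the count for \<open>P (j - 1)\<close> is
  \<open>q\<close> times that for \<open>P j\<close>, and the two terms cancel.\<close>

lemma lines_count:
  assumes "i \<le> j - 1" "w1 \<in> carrier R" "w2 \<in> carrier R"
  shows "(\<Sum>t\<in>P i. of_nat q ^ n * D j (w2 \<ominus> t \<otimes> w1) - of_nat q ^ (n - 1) * D (j - 1) (w2 \<ominus> t \<otimes> w1))
    = D (j - i) w1 * of_nat q ^ (n - i) * (of_nat q ^ n * D j w2 - of_nat q ^ (n - 1) * D (j - 1) w2)"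
proof (cases "w1 \<in> P (j - i)")
  case True
  have "w2 \<ominus> t \<otimes> w1 = w2 \<oplus> \<ominus> (t \<otimes> w1)" "\<ominus> (t \<otimes> w1) \<in> P j" if "t \<in> P i" for t
    using P_mult_P[OF that True] assms(1) j_pos by (auto intro: P_minus simp: a_minus_def)
  then have "D j (w2 \<ominus> t \<otimes> w1) = D j w2" "D (j - 1) (w2 \<ominus> t \<otimes> w1) = D (j - 1) w2" if "t \<in> P i" for t
    using that D_add assms P_j_pred by metis+
  moreover have "i \<le> n" using assms(1) j_le by simp
  ultimately show ?thesis using True by (simp add: D_def card_P)
next
  case False
  define A where "A = (\<Sum>t\<in>P i. D j (w2 \<ominus> t \<otimes> w1))"
  define B where "B = (\<Sum>t\<in>P i. D (j - 1) (w2 \<ominus> t \<otimes> w1))"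
  have "(\<Sum>t\<in>P i. D j ((w2 \<ominus> t \<otimes> w1) \<oplus> s)) = A" if s: "s \<in> P (j - 1)" for s
    using assms(2)
  proof (cases rule: pi_power_unit_cases)
    case (2 k u)
    have k: "k < j - i"
    proof (rule ccontr)
      assume "\<not> k < j - i"
      then have "w1 \<in> P (j - i)" using 2 P_I[of u k] P_mono[of "j - i" k] by (auto simp: Units_closed)
      then show False using False by simp
    qed
    obtain z where z: "z \<in> carrier R" "s = \<pi> [^] (j - 1) \<otimes> z" using s by (auto simp: P_def)
    \<comment> \<open>\<open>v\<close> is a quotient of \<open>s\<close> by \<open>w1\<close>.
      Because \<open>k \<le> j - 1 - i\<close>, it lies in \<open>P i\<close>, so translating by
      \<open>s\<close> only permutes the slopes.\<close>
    define v where "v = \<pi> [^] (j - 1 - k) \<otimes> (inv u \<otimes> z)"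
    have v: "v \<in> P i"
      using P_I[of "inv u \<otimes> z" "j - 1 - k"] P_mono[of i "j - 1 - k"] k z 2 unfolding v_def by (auto simp: subset_iff)
    then have vc: "v \<in> carrier R" by (rule P_closed)
    have "v \<otimes> w1 = (\<pi> [^] k \<otimes> \<pi> [^] (j - 1 - k)) \<otimes> ((u \<otimes> inv u) \<otimes> z)"
      using 2 z unfolding v_def by (simp add: m_ac Units_closed del: Units_r_inv)
    also have "\<dots> = s" using 2 z k by (simp add: nat_pow_mult)
    finally have sv: "s = v \<otimes> w1" by simp
    have "(\<Sum>t\<in>P i. D j ((w2 \<ominus> t \<otimes> w1) \<oplus> s)) = (\<Sum>t\<in>P i. D j (w2 \<ominus> (t \<oplus> \<ominus> v) \<otimes> w1))"
    proof (intro sum.cong refl)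
      fix t assume "t \<in> P i"
      then have "t \<in> carrier R" by (rule P_closed)
      then have "(w2 \<ominus> t \<otimes> w1) \<oplus> v \<otimes> w1 = w2 \<ominus> (t \<oplus> \<ominus> v) \<otimes> w1"
        using vc assms by algebra
      then show "D j ((w2 \<ominus> t \<otimes> w1) \<oplus> s) = D j (w2 \<ominus> (t \<oplus> \<ominus> v) \<otimes> w1)" unfolding sv by simp
    qed
    also have "\<dots> = A" unfolding A_def by (rule sum_shift) (rule P_minus[OF v])
    finally show ?thesis .
  qed (use False in simp)
  \<comment> \<open>Summing over all translations \<open>s\<close> in two orders compares
    \<open>A\<close> with \<open>B\<close>.\<close>
  then have "of_nat (card (P (j - 1))) * A = (\<Sum>s\<in>P (j - 1). \<Sum>t\<in>P i. D j ((w2 \<ominus> t \<otimes> w1) \<oplus> s))"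
    by simp
  also have "\<dots> = (\<Sum>t\<in>P i. \<Sum>s\<in>P (j - 1). D j ((w2 \<ominus> t \<otimes> w1) \<oplus> s))" by (rule sum.swap)
  also have "\<dots> = of_nat (card (P j)) * B"
    unfolding B_def sum_distrib_left using assms P_closed by (intro sum.cong refl sum_D_coset) auto
  finally have "of_nat (card (P j)) * (of_nat q * A - B) = 0"
    using card_P_pred[OF j_pos j_le] by (simp add: algebra_simps)
  then have "B = of_nat q * A" using card_P_nonzero[of j] by simp
  moreover have "(of_nat q :: complex) ^ n = of_nat q ^ (n - 1) * of_nat q"
    using n_pos by (simp flip: power_Suc2)
  ultimately have "of_nat q ^ n * A - of_nat q ^ (n - 1) * B = 0" by simp
  then show ?thesis using False unfolding A_def B_def sum_distrib_left sum_subtractf[symmetric]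
    by (simp add: D_def[of "j - i"])
qed

text \<open>Substituting \<open>x \<oplus> (s \<otimes> y \<ominus> d)\<close> for \<open>x\<close>
  turns the second condition into \<open>x \<in> P j\<close>; the first becomes a condition on
  \<open>y\<close> alone, in which \<open>y\<close> has the unit
  \<open>\<one> \<ominus> t \<otimes> s\<close> as coefficient. Hence transversal lines meet in the
  same number of points whatever the offsets \<open>c\<close> and \<open>d\<close>.\<close>

lemma line_cross:
  assumes ts: "t \<in> carrier R" "s \<in> carrier R" "\<one> \<ominus> t \<otimes> s \<in> Units R" and c: "c \<in> carrier R" "d \<in> carrier R"
  shows "(\<Sum>x\<in>carrier R. \<Sum>y\<in>carrier R. D j ((y \<ominus> t \<otimes> x) \<oplus> c) * D j ((x \<ominus> s \<otimes> y) \<oplus> d))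
    = of_nat (card (P j)) ^ 2"
proof -
  have "(\<Sum>x\<in>carrier R. D j ((y \<ominus> t \<otimes> x) \<oplus> c) * D j ((x \<ominus> s \<otimes> y) \<oplus> d))
     = of_nat (card (P j)) * D j ((\<one> \<ominus> t \<otimes> s) \<otimes> y \<oplus> (t \<otimes> d \<oplus> c))" if y: "y \<in> carrier R" for y
  proof -
    let ?e = "(\<one> \<ominus> t \<otimes> s) \<otimes> y \<oplus> (t \<otimes> d \<oplus> c)" and ?z = "s \<otimes> y \<ominus> d"
    have "(\<Sum>x\<in>carrier R. D j ((y \<ominus> t \<otimes> x) \<oplus> c) * D j ((x \<ominus> s \<otimes> y) \<oplus> d))
       = (\<Sum>x\<in>carrier R. D j ((y \<ominus> t \<otimes> (x \<oplus> ?z)) \<oplus> c) * D j (((x \<oplus> ?z) \<ominus> s \<otimes> y) \<oplus> d))"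
      using y assms by (intro sum_shift_carrier[symmetric]) simp
    also have "\<dots> = (\<Sum>x\<in>P 0. D j x * D j (?e \<oplus> (\<ominus> t) \<otimes> x))"
    proof (intro sum.cong)
      fix x assume "x \<in> P 0"
      then have x: "x \<in> carrier R" by simp
      have "(y \<ominus> t \<otimes> (x \<oplus> ?z)) \<oplus> c = ?e \<oplus> (\<ominus> t) \<otimes> x" "((x \<oplus> ?z) \<ominus> s \<otimes> y) \<oplus> d = x"
        using x y ts(1,2) c by algebra+
      then show "D j ((y \<ominus> t \<otimes> (x \<oplus> ?z)) \<oplus> c) * D j (((x \<oplus> ?z) \<ominus> s \<otimes> y) \<oplus> d)
          = D j x * D j (?e \<oplus> (\<ominus> t) \<otimes> x)" by simp
    qed simp
    also have "\<dots> = (\<Sum>x\<in>P j. D j ?e)"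
      unfolding sum_D_mult[OF le0] using y assms by (intro sum.cong refl D_add P_mult) auto
    finally show ?thesis by simp
  qed
  then have "(\<Sum>y\<in>carrier R. \<Sum>x\<in>carrier R. D j ((y \<ominus> t \<otimes> x) \<oplus> c) * D j ((x \<ominus> s \<otimes> y) \<oplus> d))
     = of_nat (card (P j)) * (\<Sum>y\<in>carrier R. D j ((\<one> \<ominus> t \<otimes> s) \<otimes> y \<oplus> (t \<otimes> d \<oplus> c)))"
    by (simp add: sum_distrib_left)
  also have "(\<Sum>y\<in>carrier R. D j ((\<one> \<ominus> t \<otimes> s) \<otimes> y \<oplus> (t \<otimes> d \<oplus> c))) = (\<Sum>y\<in>carrier R. D j (y \<oplus> (t \<otimes> d \<oplus> c)))"
    by (rule sum_unit[OF ts(3)])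
  also have "\<dots> = (\<Sum>y\<in>P 0. D j y)"
    using sum_shift_carrier[of "t \<otimes> d \<oplus> c" "D j"] ts c by simp
  also have "\<dots> = of_nat (card (P j))" by (rule sum_D) simp
  finally show ?thesis by (subst sum.swap) (simp add: power2_eq_square)
qed

end

section \<open>Perfect functions and the inductive step\<close>

context finite_chain_ring begin

text \<open>A perfect array of \<open>h\<close>th roots of unity on the square of the quotient by
  \<open>P j\<close>, pulled back to pairs from \<open>R\<close> so that the ring stays fixed during
  the induction. The peak is the squared order of the ring; for \<open>j = n\<close> the
  autocorrelation vanishes off the origin because \<open>P n\<close> is zero.\<close>

definition perfect :: "nat \<Rightarrow> nat \<Rightarrow> ('a \<Rightarrow> 'a \<Rightarrow> complex) \<Rightarrow> bool" where
  "perfect h j f \<longleftrightarrow>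
     (\<forall>x\<in>carrier R. \<forall>y\<in>carrier R. f x y ^ h = 1) \<and>
     (\<forall>x\<in>carrier R. \<forall>y\<in>carrier R. \<forall>s\<in>P j. \<forall>z\<in>P j. f (x \<oplus> s) (y \<oplus> z) = f x y) \<and>
     (\<forall>w1\<in>carrier R. \<forall>w2\<in>carrier R. corr f f w1 w2 = of_nat q ^ (2 * n) * D j w1 * D j w2)"

lemma corr_add_left: "corr (\<lambda>x y. F x y + F' x y) G w1 w2 = corr F G w1 w2 + corr F' G w1 w2"
  by (simp add: corr_def distrib_right sum.distrib)

lemma corr_add_right: "corr F (\<lambda>x y. G x y + G' x y) w1 w2 = corr F G w1 w2 + corr F G' w1 w2"
  by (simp add: corr_def distrib_left sum.distrib)

lemma corr_swap: "corr (\<lambda>x y. F y x) (\<lambda>x y. G y x) w1 w2 = corr F G w2 w1"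
  unfolding corr_def by (rule sum.swap)

lemma perfect_0: "perfect h 0 (\<lambda>x y. 1)"
  by (auto simp: perfect_def corr_def D_def card_carrier power_mult power2_eq_square mult_2 power_add)

end

context balanced_function begin

lemma sum_phi: "i \<le> j - 1 \<Longrightarrow> (\<Sum>t\<in>P i. \<phi> t) = 0"
  by (rule sum_zero_by_cosets[of i "j - 1"]) (auto intro!: phi_sum[unfolded One_nat_def] P_closed)

lemma corr_lines_self:
  assumes "i \<le> j - 1" "w1 \<in> carrier R" "w2 \<in> carrier R"
  shows "corr (lines i) (lines i) w1 w2 =
    D (j - i) w1 * of_nat q ^ (n - i) * (of_nat q ^ n * D j w2 - of_nat q ^ (n - 1) * D (j - 1) w2)"
  using corr_lines_self_sum[OF assms] lines_count[OF assms] by simp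

lemma one_minus_unit:
  assumes "t \<in> carrier R" "s \<in> P 1"
  shows "\<one> \<ominus> t \<otimes> s \<in> Units R" "\<one> \<ominus> s \<otimes> t \<in> Units R"
proof -
  show "\<one> \<ominus> t \<otimes> s \<in> Units R"
    unfolding a_minus_def using assms by (intro Units_add P_minus P_mult) auto
  then show "\<one> \<ominus> s \<otimes> t \<in> Units R"
    using assms P_closed[OF assms(2)] by (simp add: m_comm)
qed

text \<open>For lines \<open>y = t x\<close> and \<open>x = s y\<close> with
  \<open>s \<in> P 1\<close>, the element \<open>\<one> \<ominus> t \<otimes> s\<close> is a unit,
  so by \<open>line_cross\<close> all pairs contribute the same number. The double sum of weights
  then factors, and its factor over \<open>P 0\<close> is zero.\<close>

lemma corr_lines_cross:
  assumes "w1 \<in> carrier R" "w2 \<in> carrier R"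
  shows "corr (lines 0) (\<lambda>x y. lines 1 y x) w1 w2 = 0"
    and "corr (\<lambda>x y. lines 1 y x) (lines 0) w1 w2 = 0"
proof -
  define c where "c = (of_nat (card (P j)) :: complex)"
  have phi_0: "(\<Sum>t\<in>P 0. \<phi> t) = 0" by (rule sum_phi) simp
  have "cnj (\<Sum>t\<in>P 0. \<phi> t) = 0" unfolding phi_0 by simp
  then have cnj_phi_0: "(\<Sum>t\<in>P 0. cnj (\<phi> t)) = 0" unfolding cnj_sum .
  have sum_sum_mult: "(\<Sum>s\<in>A. \<Sum>t\<in>B. a s * b t * k) = (\<Sum>s\<in>A. a s) * (\<Sum>t\<in>B. b t) * k"
    for A B and a b :: "'a \<Rightarrow> complex" and k
    unfolding sum_product unfolding sum_distrib_right by (rule refl)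
  have "(\<Sum>x\<in>carrier R. \<Sum>y\<in>carrier R. D j ((y \<oplus> w2) \<ominus> t \<otimes> (x \<oplus> w1)) * D j (x \<ominus> s \<otimes> y)) = c\<^sup>2"
    if t: "t \<in> P 0" and s: "s \<in> P 1" for t s
  proof -
    have c: "t \<in> carrier R" "s \<in> carrier R" using t s P_closed by auto
    have "(\<Sum>x\<in>carrier R. \<Sum>y\<in>carrier R. D j ((y \<oplus> w2) \<ominus> t \<otimes> (x \<oplus> w1)) * D j (x \<ominus> s \<otimes> y))
      = (\<Sum>x\<in>carrier R. \<Sum>y\<in>carrier R. D j ((y \<ominus> t \<otimes> x) \<oplus> (w2 \<ominus> t \<otimes> w1)) * D j ((x \<ominus> s \<otimes> y) \<oplus> \<zero>))"
    proof (intro sum.cong refl)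
      fix x y assume "x \<in> carrier R" "y \<in> carrier R"
      moreover from this have "(y \<oplus> w2) \<ominus> t \<otimes> (x \<oplus> w1) = (y \<ominus> t \<otimes> x) \<oplus> (w2 \<ominus> t \<otimes> w1)"
        using c assms by algebra
      ultimately show "D j ((y \<oplus> w2) \<ominus> t \<otimes> (x \<oplus> w1)) * D j (x \<ominus> s \<otimes> y)
        = D j ((y \<ominus> t \<otimes> x) \<oplus> (w2 \<ominus> t \<otimes> w1)) * D j ((x \<ominus> s \<otimes> y) \<oplus> \<zero>)" using c by simp
    qed
    then show ?thesis
      unfolding c_def using line_cross[of t s "w2 \<ominus> t \<otimes> w1" \<zero>] c one_minus_unit s assms by simp
  qed
  then have "corr (lines 0) (\<lambda>x y. lines 1 y x) w1 w2 =
      (\<Sum>t\<in>P 0. \<Sum>s\<in>P 1. \<phi> t * cnj (\<phi> s) * c\<^sup>2) / c\<^sup>2"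
    unfolding lines_def by (subst corr_superposition) (simp add: c_def power2_eq_square del: P_0)
  also have "\<dots> = 0" unfolding sum_sum_mult phi_0 by simp
  finally show "corr (lines 0) (\<lambda>x y. lines 1 y x) w1 w2 = 0" .
  have "(\<Sum>x\<in>carrier R. \<Sum>y\<in>carrier R. D j ((x \<oplus> w1) \<ominus> s \<otimes> (y \<oplus> w2)) * D j (y \<ominus> t \<otimes> x)) = c\<^sup>2"
    if t: "t \<in> P 0" and s: "s \<in> P 1" for t s
  proof -
    have c: "t \<in> carrier R" "s \<in> carrier R" using t s P_closed by auto
    have "(\<Sum>x\<in>carrier R. \<Sum>y\<in>carrier R. D j ((x \<oplus> w1) \<ominus> s \<otimes> (y \<oplus> w2)) * D j (y \<ominus> t \<otimes> x))
      = (\<Sum>x\<in>carrier R. \<Sum>y\<in>carrier R. D j ((y \<ominus> t \<otimes> x) \<oplus> \<zero>) * D j ((x \<ominus> s \<otimes> y) \<oplus> (w1 \<ominus> s \<otimes> w2)))"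
    proof (intro sum.cong refl)
      fix x y assume "x \<in> carrier R" "y \<in> carrier R"
      moreover from this have "(x \<oplus> w1) \<ominus> s \<otimes> (y \<oplus> w2) = (x \<ominus> s \<otimes> y) \<oplus> (w1 \<ominus> s \<otimes> w2)"
        using c assms by algebra
      ultimately show "D j ((x \<oplus> w1) \<ominus> s \<otimes> (y \<oplus> w2)) * D j (y \<ominus> t \<otimes> x)
        = D j ((y \<ominus> t \<otimes> x) \<oplus> \<zero>) * D j ((x \<ominus> s \<otimes> y) \<oplus> (w1 \<ominus> s \<otimes> w2))" using c by simp
    qed
    then show ?thesis
      unfolding c_def using line_cross[of t s \<zero> "w1 \<ominus> s \<otimes> w2"] c one_minus_unit s assms by simp
  qed
  then have "corr (\<lambda>x y. lines 1 y x) (lines 0) w1 w2 =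
      (\<Sum>s\<in>P 1. \<Sum>t\<in>P 0. \<phi> s * cnj (\<phi> t) * c\<^sup>2) / c\<^sup>2"
    unfolding lines_def by (subst corr_superposition) (simp add: c_def power2_eq_square del: P_0)
  also have "\<dots> = 0" unfolding sum_sum_mult cnj_phi_0 by simp
  finally show "corr (\<lambda>x y. lines 1 y x) (lines 0) w1 w2 = 0" .
qed

lemma lines_add:
  assumes "x \<in> carrier R" "y \<in> carrier R" "s \<in> P j" "z \<in> P j"
  shows "lines i (x \<oplus> s) (y \<oplus> z) = lines i x y"
proof -
  have "D j ((y \<oplus> z) \<ominus> t \<otimes> (x \<oplus> s)) = D j (y \<ominus> t \<otimes> x)" if "t \<in> P i" for t
  proof -
    have t: "t \<in> carrier R" using that by (rule P_closed)
    have "z \<ominus> t \<otimes> s \<in> P j" using t assms P_diff P_mult by simp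
    moreover have "(y \<oplus> z) \<ominus> t \<otimes> (x \<oplus> s) = (y \<ominus> t \<otimes> x) \<oplus> (z \<ominus> t \<otimes> s)"
      using t assms(1,2) P_closed[OF assms(3)] P_closed[OF assms(4)] by algebra
    ultimately show ?thesis using D_add t assms by simp
  qed
  then show ?thesis by (simp add: lines_def)
qed

text \<open>At a unit \<open>x\<close>, the condition
  \<open>y \<ominus> t \<otimes> x \<in> P j\<close> says that \<open>t\<close> is congruent to
  \<open>y \<otimes> inv x\<close> modulo \<open>P j\<close>. By \<open>i \<le> j\<close> this class
  is contained in \<open>P i\<close> or disjoint from it, and the division by
  \<open>card (P j)\<close> leaves a single value of \<open>\<phi>\<close>.\<close>

lemma lines_unit:
  assumes x: "x \<in> Units R" and y: "y \<in> carrier R" and i: "i \<le> j"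
  shows "lines i x y = (if y \<otimes> inv x \<in> P i then \<phi> (y \<otimes> inv x) else 0)"
proof -
  define r where "r = y \<otimes> inv x"
  have r: "r \<in> carrier R" "y = x \<otimes> r"
    unfolding r_def using x y by (simp_all add: m_lcomm[of x] Units_closed)
  have D: "D j (y \<ominus> t \<otimes> x) = D j (t \<ominus> r)" if "t \<in> carrier R" for t
  proof -
    have "y \<ominus> t \<otimes> x = x \<otimes> (\<ominus> (t \<ominus> r))"
      unfolding r(2) using that r(1) Units_closed[OF x] by algebra
    moreover have "D j (\<ominus> (t \<ominus> r)) = D j (t \<ominus> r)"
      using that r(1) P_minus[of "t \<ominus> r" j] P_minus[of "\<ominus> (t \<ominus> r)" j] by (auto simp: D_def)
    ultimately show ?thesis using that r(1) x by (simp add: D_unit)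
  qed
  show ?thesis
  proof (cases "r \<in> P i")
    case True
    have "(\<Sum>t\<in>P i. \<phi> t * D j (y \<ominus> t \<otimes> x)) = (\<Sum>t\<in>P i. \<phi> (t \<oplus> r) * D j (y \<ominus> (t \<oplus> r) \<otimes> x))"
      by (rule sum_shift[OF True, symmetric])
    also have "\<dots> = (\<Sum>t\<in>P i. D j t * \<phi> (r \<oplus> t))"
    proof (intro sum.cong refl)
      fix t assume "t \<in> P i"
      then have t: "t \<in> carrier R" by (rule P_closed)
      have "(t \<oplus> r) \<ominus> r = t" using t r(1) by algebra
      then show "\<phi> (t \<oplus> r) * D j (y \<ominus> (t \<oplus> r) \<otimes> x) = D j t * \<phi> (r \<oplus> t)"
        using D[of "t \<oplus> r"] t r(1) by (simp add: a_comm)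
    qed
    also have "\<dots> = (\<Sum>t\<in>P j. \<phi> r)"
      unfolding sum_D_mult[OF i] using r phi_add by (intro sum.cong) auto
    finally show ?thesis using True card_P_nonzero[of j] by (simp add: lines_def r_def)
  next
    case False
    have "D j (y \<ominus> t \<otimes> x) = 0" if t: "t \<in> P i" for t
    proof -
      have tc: "t \<in> carrier R" using t by (rule P_closed)
      have "t \<ominus> r \<notin> P j"
      proof
        assume "t \<ominus> r \<in> P j"
        then have "t \<ominus> (t \<ominus> r) \<in> P i" using t P_mono[OF i] P_diff by blast
        moreover have "t \<ominus> (t \<ominus> r) = r" using tc r(1) by algebra
        ultimately show False using False by simp
      qed
      then show ?thesis using D[OF tc] by (simp add: D_def)
    qed
    then show ?thesis using False by (simp add: lines_def r_def)
  qed
qed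

text \<open>For \<open>x \<in> P 1\<close>, changing the slope by an element of
  \<open>P (j - 1)\<close> changes \<open>t \<otimes> x\<close> only within \<open>P j\<close>. So
  the indicator is constant on the cosets over which \<open>\<phi>\<close> sums to zero.\<close>

lemma lines_nonunit:
  assumes x: "x \<in> P 1" and y: "y \<in> carrier R" and i: "i \<le> j - 1"
  shows "lines i x y = 0"
proof -
  have "(\<Sum>t\<in>P i. \<phi> t * D j (y \<ominus> t \<otimes> x)) = 0"
  proof (rule sum_zero_by_cosets[OF i])
    fix t assume "t \<in> P i"
    then have t: "t \<in> carrier R" by (rule P_closed)
    have xc: "x \<in> carrier R" using x by (rule P_closed)
    have "D j (y \<ominus> (t \<oplus> s) \<otimes> x) = D j (y \<ominus> t \<otimes> x)" if s: "s \<in> P (j - 1)" for s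
    proof -
      have "y \<ominus> (t \<oplus> s) \<otimes> x = (y \<ominus> t \<otimes> x) \<oplus> \<ominus> (s \<otimes> x)"
        using t P_closed[OF s] xc y by algebra
      then show ?thesis
        using D_add[OF P_minus[OF P_pred_mult_P_1[OF j_pos s x]]] t xc y by simp
    qed
    then have "(\<Sum>s\<in>P (j - 1). \<phi> (t \<oplus> s) * D j (y \<ominus> (t \<oplus> s) \<otimes> x))
        = (\<Sum>s\<in>P (j - 1). \<phi> (t \<oplus> s)) * D j (y \<ominus> t \<otimes> x)"
      by (simp add: sum_distrib_right)
    then show "(\<Sum>s\<in>P (j - 1). \<phi> (t \<oplus> s) * D j (y \<ominus> (t \<oplus> s) \<otimes> x)) = 0"
      using phi_sum[OF t] by simp
  qed
  then show ?thesis by (simp add: lines_def)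
qed

text \<open>At a unit \<open>x\<close>, moving \<open>y\<close> through a coset of
  \<open>P (j - 1)\<close> moves the slope \<open>y \<otimes> inv x\<close> through one as well, and
  there \<open>\<phi>\<close> sums to zero. At a nonunit every term is already zero.\<close>

lemma sum_lines_coset:
  assumes x: "x \<in> carrier R" and y: "y \<in> carrier R" and i: "i \<le> j - 1"
  shows "(\<Sum>z\<in>P (j - 1). lines i x (y \<oplus> z)) = 0"
proof (cases "x \<in> Units R")
  case True
  define r where "r = y \<otimes> inv x"
  have r: "r \<in> carrier R" unfolding r_def using True y by simp
  have "lines i x (y \<oplus> z) = (if r \<in> P i then \<phi> (r \<oplus> inv x \<otimes> z) else 0)" if z: "z \<in> P (j - 1)" for z
  proof -
    have eq: "(y \<oplus> z) \<otimes> inv x = r \<oplus> inv x \<otimes> z"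
      unfolding r_def using True y P_closed[OF z] by (simp add: l_distr m_comm[of z])
    have "inv x \<otimes> z \<in> P i" using P_mult[of "inv x" z "j - 1"] True z P_mono[OF i] by auto
    then show ?thesis
      using lines_unit[OF True, of "y \<oplus> z" i] y P_closed[OF z] i P_add_iff r unfolding eq by simp
  qed
  then have "(\<Sum>z\<in>P (j - 1). lines i x (y \<oplus> z)) =
      (if r \<in> P i then (\<Sum>z\<in>P (j - 1). \<phi> (r \<oplus> inv x \<otimes> z)) else 0)"
    by simp
  also have "(\<Sum>z\<in>P (j - 1). \<phi> (r \<oplus> inv x \<otimes> z)) = (\<Sum>z\<in>P (j - 1). \<phi> (r \<oplus> z))"
    by (rule sum.reindex_bij_witness[of _ "\<lambda>z. x \<otimes> z" "\<lambda>z. inv x \<otimes> z"])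
       (use True P_closed in \<open>auto simp: m_assoc[symmetric] Units_closed intro: P_mult\<close>)
  also have "\<dots> = 0" by (rule phi_sum[OF r])
  finally show ?thesis by simp
next
  case False
  then have "x \<in> P 1" using Units_iff[OF x] by simp
  then show ?thesis using lines_nonunit[OF _ _ i] y P_closed by simp
qed

lemma sum_lines_mult:
  assumes x: "x \<in> carrier R" and w: "w \<in> carrier R" and i: "i \<le> j - 1"
    and H: "\<And>y z. y \<in> carrier R \<Longrightarrow> z \<in> P (j - 1) \<Longrightarrow> H (y \<oplus> z) = H y"
  shows "(\<Sum>y\<in>carrier R. lines i x (y \<oplus> w) * H y) = 0"
proof -
  have "(\<Sum>y\<in>P 0. lines i x (y \<oplus> w) * H y) = 0"
  proof (rule sum_zero_by_cosets[of _ "j - 1"])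
    fix y assume "y \<in> P 0"
    then have y: "y \<in> carrier R" by simp
    have "(\<Sum>z\<in>P (j - 1). lines i x ((y \<oplus> z) \<oplus> w) * H (y \<oplus> z))
        = (\<Sum>z\<in>P (j - 1). lines i x ((y \<oplus> w) \<oplus> z)) * H y"
      unfolding sum_distrib_right
    proof (intro sum.cong refl)
      fix z assume z: "z \<in> P (j - 1)"
      then have "(y \<oplus> z) \<oplus> w = (y \<oplus> w) \<oplus> z" using y w P_closed by (simp add: a_ac)
      then show "lines i x ((y \<oplus> z) \<oplus> w) * H (y \<oplus> z) = lines i x ((y \<oplus> w) \<oplus> z) * H y"
        using H[OF y z] by simp
    qed
    then show "(\<Sum>z\<in>P (j - 1). lines i x ((y \<oplus> z) \<oplus> w) * H (y \<oplus> z)) = 0"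
      using sum_lines_coset[OF x _ i] y w by simp
  qed simp
  then show ?thesis by simp
qed

text \<open>Sum over \<open>y\<close> first, one coset of \<open>P (j - 1)\<close> at a time:
  \<open>H\<close> is constant there and \<open>lines\<close> sums to zero. This removes the mixed
  terms with the part of the construction that is not made of lines.\<close>

lemma corr_lines_invariant:
  assumes i: "i \<le> j - 1" and w: "w1 \<in> carrier R" "w2 \<in> carrier R"
    and H: "\<And>x y z. x \<in> carrier R \<Longrightarrow> y \<in> carrier R \<Longrightarrow> z \<in> P (j - 1) \<Longrightarrow> H x (y \<oplus> z) = H x y"
  shows "corr (lines i) H w1 w2 = 0" "corr H (lines i) w1 w2 = 0"
proof -
  show "corr (lines i) H w1 w2 = 0"
    unfolding corr_def using w H by (intro sum.neutral ballI sum_lines_mult[OF _ _ i]) auto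
  have "(\<Sum>y\<in>carrier R. H (x \<oplus> w1) (y \<oplus> w2) * cnj (lines i x y)) = 0" if x: "x \<in> carrier R" for x
  proof -
    have "(\<Sum>y\<in>carrier R. lines i x (y \<oplus> \<zero>) * cnj (H (x \<oplus> w1) (y \<oplus> w2))) = 0"
    proof (rule sum_lines_mult[OF x _ i])
      fix y z assume y: "y \<in> carrier R" and z: "z \<in> P (j - 1)"
      have "H (x \<oplus> w1) ((y \<oplus> z) \<oplus> w2) = H (x \<oplus> w1) ((y \<oplus> w2) \<oplus> z)"
        using y w P_closed[OF z] by (simp add: a_ac)
      then show "cnj (H (x \<oplus> w1) ((y \<oplus> z) \<oplus> w2)) = cnj (H (x \<oplus> w1) (y \<oplus> w2))"
        using H y w x z by simp
    qed simp
    then have "cnj (\<Sum>y\<in>carrier R. lines i x y * cnj (H (x \<oplus> w1) (y \<oplus> w2))) = 0" by simp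
    then show ?thesis by (simp add: mult.commute)
  qed
  then show "corr H (lines i) w1 w2 = 0" by (simp add: corr_def)
qed

text \<open>The function is \<open>\<phi>\<close> of the slope at units \<open>x\<close> and 1
  elsewhere. Because \<open>P (j - 1)\<close> is the whole ring here, the lines leave an unwanted
  term, minus \<open>q ^ (2 * n - 1)\<close> times \<open>D 1 w1\<close>; the autocorrelation of the
  indicator \<open>H\<close> of nonunit \<open>x\<close> is its opposite.\<close>

lemma perfect_1:
  assumes h: "\<And>t. t \<in> carrier R \<Longrightarrow> \<phi> t ^ h = 1" and j: "j = 1"
  shows "\<exists>f. perfect h j f"
proof -
  define H where "H x y = D 1 x" for x y :: 'a
  define f where "f x y = lines 0 x y + H x y" for x y
  have "f x y ^ h = 1" if x: "x \<in> carrier R" and y: "y \<in> carrier R" for x y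
  proof (cases "x \<in> P 1")
    case True
    then show ?thesis using lines_nonunit[OF True y, of 0] by (simp add: f_def H_def D_def)
  next
    case False
    then have "x \<in> Units R" using Units_iff[OF x] by simp
    then show ?thesis using lines_unit[of x y 0] h y False by (simp add: f_def H_def D_def)
  qed
  moreover have "f (x \<oplus> s) (y \<oplus> z) = f x y"
    if "x \<in> carrier R" "y \<in> carrier R" "s \<in> P j" "z \<in> P j" for x y s z
    using lines_add[OF that] D_add that j by (simp add: f_def H_def)
  moreover have "corr f f w1 w2 = of_nat q ^ (2 * n) * D j w1 * D j w2"
    if w: "w1 \<in> carrier R" "w2 \<in> carrier R" for w1 w2
  proof -
    have q2: "(of_nat q :: complex) ^ (2 * n) = of_nat q ^ n * of_nat q ^ n"
      by (simp add: mult_2 power_add)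
    have "(\<Sum>x\<in>P 0. D 1 x * D 1 (x \<oplus> w1)) = (\<Sum>x\<in>P 1. D 1 w1)"
      unfolding sum_D_mult[OF le0]
      using w D_add[of _ 1 w1] by (intro sum.cong) (auto simp: a_comm P_closed)
    then have "corr H H w1 w2 = of_nat q ^ n * of_nat q ^ (n - 1) * D 1 w1"
      using n_pos by (simp add: corr_def H_def sum_distrib_left[symmetric] card_carrier card_P mult_ac)
    moreover have "corr (lines 0) (lines 0) w1 w2 = D 1 w1 * of_nat q ^ n * (of_nat q ^ n * D 1 w2 - of_nat q ^ (n - 1))"
      using corr_lines_self[of 0 w1 w2] w j by (simp add: D_def[of 0])
    moreover have "corr (lines 0) H w1 w2 = 0" "corr H (lines 0) w1 w2 = 0"
      using corr_lines_invariant[of 0 w1 w2 H] w by (simp_all add: H_def)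
    ultimately show ?thesis
      unfolding f_def[abs_def] corr_add_left corr_add_right q2 j by (simp add: algebra_simps)
  qed
  ultimately have "perfect h j f" by (simp add: perfect_def)
  then show ?thesis by (rule exI[of _ f])
qed

lemma perfect_step:
  assumes h: "\<And>t. t \<in> carrier R \<Longrightarrow> \<phi> t ^ h = 1" and j: "j \<ge> 2" and g: "perfect h (j - 2) g"
  shows "\<exists>f. perfect h j f"
proof -
  \<comment> \<open>Division by \<open>\<pi>\<close> is determined only modulo the annihilator
    \<open>P (n - 1)\<close>. This lies in \<open>P (j - 2)\<close>, and \<open>g\<close> is
    invariant under \<open>P (j - 2)\<close>, so the choice does not affect
    \<open>G\<close>.\<close>
  define e where "e x = (SOME z. z \<in> carrier R \<and> \<pi> \<otimes> z = x)" for x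
  define G where "G x y = (if x \<in> P 1 \<and> y \<in> P 1 then g (e x) (e y) else 0)" for x y
  define f where "f x y = (lines 0 x y + lines 1 y x) + G x y" for x y
  have e: "e (\<pi> \<otimes> x) \<in> carrier R" "\<exists>s\<in>P (j - 2). e (\<pi> \<otimes> x) = x \<oplus> s" if x: "x \<in> carrier R" for x
  proof -
    have e': "e (\<pi> \<otimes> x) \<in> carrier R \<and> \<pi> \<otimes> e (\<pi> \<otimes> x) = \<pi> \<otimes> x"
      unfolding e_def by (rule someI[of _ x]) (use x in simp)
    then show ec: "e (\<pi> \<otimes> x) \<in> carrier R" by simp
    have "\<pi> \<otimes> (e (\<pi> \<otimes> x) \<ominus> x) = \<pi> \<otimes> e (\<pi> \<otimes> x) \<ominus> \<pi> \<otimes> x" using ec x pi_closed by algebra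
    also have "\<dots> = \<zero>" using e' x by (simp add: a_minus_def r_neg)
    finally have "e (\<pi> \<otimes> x) \<ominus> x \<in> P (n - 1)"
      using pi_pow_mult_mem_iff[of "e (\<pi> \<otimes> x) \<ominus> x" n 1] ec x by simp
    then have "e (\<pi> \<otimes> x) \<ominus> x \<in> P (j - 2)" using P_mono[of "j - 2" "n - 1"] j_le j by (auto simp: subset_iff)
    moreover have "e (\<pi> \<otimes> x) = x \<oplus> (e (\<pi> \<otimes> x) \<ominus> x)" using ec x by algebra
    ultimately show "\<exists>s\<in>P (j - 2). e (\<pi> \<otimes> x) = x \<oplus> s" by blast
  qed
  have P1: "\<pi> \<otimes> x \<in> P 1" if "x \<in> carrier R" for x using P_I[of x 1] that by simp
  have P1E: "\<exists>x'\<in>carrier R. x = \<pi> \<otimes> x'" if "x \<in> P 1" for x using that by (auto simp: P_def)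
  have ginv: "g (x \<oplus> s) (y \<oplus> z) = g x y"
    if "x \<in> carrier R" "y \<in> carrier R" "s \<in> P (j - 2)" "z \<in> P (j - 2)" for x y s z
    using g that by (simp add: perfect_def)
  have G_pi: "G (\<pi> \<otimes> x) (\<pi> \<otimes> y) = g x y" if "x \<in> carrier R" "y \<in> carrier R" for x y
    using e[OF that(1)] e[OF that(2)] P1 ginv that by (auto simp: G_def)
  \<comment> \<open>\<open>\<pi>\<close> times \<open>P (j - 2)\<close> is \<open>P (j - 1)\<close>,
    so \<open>G\<close> is invariant even under \<open>P (j - 1)\<close>; orthogonality to the lines
    rests on this.\<close>
  have Ginv: "G (x \<oplus> s) (y \<oplus> z) = G x y"
    if x: "x \<in> carrier R" and y: "y \<in> carrier R" and s: "s \<in> P (j - 1)" and z: "z \<in> P (j - 1)" for x y s z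
  proof (cases "x \<in> P 1 \<and> y \<in> P 1")
    case True
    then obtain x' y' where x': "x' \<in> carrier R" "x = \<pi> \<otimes> x'" and y': "y' \<in> carrier R" "y = \<pi> \<otimes> y'"
      using P1E by blast
    have div: "\<exists>s'\<in>P (j - 2). s = \<pi> \<otimes> s'" if s: "s \<in> P (j - 1)" for s
    proof -
      obtain a where a: "a \<in> carrier R" "s = \<pi> [^] (j - 1) \<otimes> a" using s by (auto simp: P_def)
      have "j - 1 = 1 + (j - 2)" using j by simp
      then have "\<pi> [^] (j - 1) = \<pi> [^] (1::nat) \<otimes> \<pi> [^] (j - 2)" by (simp only: nat_pow_mult pi_closed)
      then have "s = \<pi> \<otimes> (\<pi> [^] (j - 2) \<otimes> a)" using a by (simp add: m_assoc)
      then show ?thesis using P_I[OF a(1)] by blast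
    qed
    obtain s' z' where s': "s' \<in> P (j - 2)" "s = \<pi> \<otimes> s'" and z': "z' \<in> P (j - 2)" "z = \<pi> \<otimes> z'"
      using div s z by blast
    have "x \<oplus> s = \<pi> \<otimes> (x' \<oplus> s')" "y \<oplus> z = \<pi> \<otimes> (y' \<oplus> z')"
      using x' y' s' z' P_closed by (simp_all add: r_distr)
    then show ?thesis using G_pi ginv x' y' s' z' P_closed by simp
  next
    case False
    have "s \<in> P 1" "z \<in> P 1" using s z P_mono[of 1 "j - 1"] j by (auto simp: subset_iff)
    then have "x \<oplus> s \<in> P 1 \<longleftrightarrow> x \<in> P 1" "y \<oplus> z \<in> P 1 \<longleftrightarrow> y \<in> P 1" using P_add_iff x y by auto
    then show ?thesis using False by (auto simp: G_def)
  qed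
  \<comment> \<open>Multiplication by \<open>\<pi>\<close> is \<open>q\<close>-to-one onto
    \<open>P 1\<close>, so passing from \<open>g\<close> to \<open>G\<close> divides the correlation
    by \<open>q\<close> once for each coordinate. A shift \<open>\<pi> \<otimes> v\<close> is in
    \<open>P (j - 1)\<close> exactly if \<open>v\<close> is in \<open>P (j - 2)\<close>.\<close>
  have corr_G: "corr G G w1 w2 = of_nat q ^ (2 * n - 2) * D (j - 1) w1 * D (j - 1) w2"
    if w: "w1 \<in> carrier R" "w2 \<in> carrier R" for w1 w2
  proof (cases "w1 \<in> P 1 \<and> w2 \<in> P 1")
    case True
    then obtain v1 v2 where v1: "v1 \<in> carrier R" "w1 = \<pi> \<otimes> v1" and v2: "v2 \<in> carrier R" "w2 = \<pi> \<otimes> v2"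
      using P1E by blast
    let ?T = "\<lambda>x y. G (x \<oplus> w1) (y \<oplus> w2) * cnj (G x y)"
    have pi_sum: "(\<Sum>x\<in>carrier R. F (\<pi> \<otimes> x)) = of_nat q * (\<Sum>x\<in>P 1. F x)" for F :: "'a \<Rightarrow> complex"
      using sum_pi_pow_mult[of 1 F] n_pos by (simp add: card_P)
    have "corr G G w1 w2 = (\<Sum>x\<in>P 1. \<Sum>y\<in>carrier R. ?T x y)"
      unfolding corr_def
      by (intro sum.mono_neutral_right finite_carrier) (auto simp: P_closed G_def)
    also have "\<dots> = (\<Sum>x\<in>P 1. \<Sum>y\<in>P 1. ?T x y)"
      by (intro sum.cong refl sum.mono_neutral_right finite_carrier) (auto simp: P_closed G_def)
    finally have reduce: "corr G G w1 w2 = (\<Sum>x\<in>P 1. \<Sum>y\<in>P 1. ?T x y)" .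
    have "(\<Sum>x\<in>carrier R. \<Sum>y\<in>carrier R. ?T (\<pi> \<otimes> x) (\<pi> \<otimes> y))
        = of_nat q * (\<Sum>x\<in>P 1. \<Sum>y\<in>carrier R. ?T x (\<pi> \<otimes> y))"
      by (rule pi_sum[of "\<lambda>x. \<Sum>y\<in>carrier R. ?T x (\<pi> \<otimes> y)"])
    also have "(\<Sum>x\<in>P 1. \<Sum>y\<in>carrier R. ?T x (\<pi> \<otimes> y)) = (\<Sum>x\<in>P 1. of_nat q * (\<Sum>y\<in>P 1. ?T x y))"
      by (intro sum.cong refl) (rule pi_sum)
    finally have "of_nat q ^ 2 * corr G G w1 w2 = (\<Sum>x\<in>carrier R. \<Sum>y\<in>carrier R. ?T (\<pi> \<otimes> x) (\<pi> \<otimes> y))"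
      unfolding reduce by (simp only: sum_distrib_left power2_eq_square mult.assoc)
    also have "\<dots> = corr g g v1 v2"
    proof -
      have "?T (\<pi> \<otimes> x) (\<pi> \<otimes> y) = g (x \<oplus> v1) (y \<oplus> v2) * cnj (g x y)"
        if "x \<in> carrier R" "y \<in> carrier R" for x y
        using that v1 v2 G_pi[of x y] G_pi[of "x \<oplus> v1" "y \<oplus> v2"] by (simp add: r_distr)
      then show ?thesis by (simp add: corr_def)
    qed
    also have "\<dots> = of_nat q ^ (2 * n) * D (j - 2) v1 * D (j - 2) v2"
      using g v1 v2 by (simp add: perfect_def)
    also have "\<dots> = of_nat q ^ (2 * n) * D (j - 1) w1 * D (j - 1) w2"
      using pi_pow_mult_mem_iff[of _ "j - 1" 1] v1 v2 j_le by (simp add: D_def numeral_2_eq_2)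
    finally have "of_nat q ^ 2 * corr G G w1 w2 = of_nat q ^ (2 * n) * D (j - 1) w1 * D (j - 1) w2" .
    moreover have q2: "(of_nat q :: complex) ^ (2 * n) = of_nat q ^ 2 * of_nat q ^ (2 * n - 2)"
    proof -
      have "2 * n = 2 + (2 * n - 2)" using n_pos by simp
      then show ?thesis by (metis power_add)
    qed
    ultimately have "of_nat q ^ 2 * corr G G w1 w2 = of_nat q ^ 2 * (of_nat q ^ (2 * n - 2) * D (j - 1) w1 * D (j - 1) w2)"
      unfolding q2 by (simp only: mult.assoc)
    then show ?thesis using q_pos by (simp only: mult_cancel_left) simp
  next
    case False
    \<comment> \<open>A shift with a component outside \<open>P 1\<close> moves the support of
      \<open>G\<close> off itself.\<close>
    have "G (x \<oplus> w1) (y \<oplus> w2) * cnj (G x y) = 0" if "x \<in> carrier R" "y \<in> carrier R" for x y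
      using False P_add_iff[of x 1 w1] P_add_iff[of y 1 w2] that w a_comm[of x w1] a_comm[of y w2]
      unfolding G_def by (simp split: if_split) blast
    then have "corr G G w1 w2 = 0" unfolding corr_def by (intro sum.neutral ballI)
    then show ?thesis using False P_mono[of 1 "j - 1"] j by (auto simp: D_def subset_iff)
  qed
  have "f x y ^ h = 1" if x: "x \<in> carrier R" and y: "y \<in> carrier R" for x y
  proof (cases "x \<in> P 1")
    case xn: True
    show ?thesis
    proof (cases "y \<in> P 1")
      case True
      obtain x' y' where "x' \<in> carrier R" "x = \<pi> \<otimes> x'" "y' \<in> carrier R" "y = \<pi> \<otimes> y'"
        using P1E xn True by blast
      then have "G x y ^ h = 1" using G_pi g by (simp add: perfect_def)
      then show ?thesis using lines_nonunit[OF xn y, of 0] lines_nonunit[OF True x, of 1] j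
        by (simp add: f_def)
    next
      case False
      then have u: "y \<in> Units R" using Units_iff[OF y] by simp
      then have "x \<otimes> inv y \<in> P 1" using P_mult[of "inv y" x 1] xn by (simp add: m_comm x)
      then show ?thesis using lines_nonunit[OF xn y, of 0] lines_unit[OF u x, of 1] j False h P_closed
        by (simp add: f_def G_def)
    qed
  next
    case False
    then have u: "x \<in> Units R" using Units_iff[OF x] by simp
    have "lines 1 y x = 0"
    proof (cases "y \<in> P 1")
      case True
      then show ?thesis using lines_nonunit[OF True x, of 1] j by simp
    next
      case yn: False
      then have v: "y \<in> Units R" using Units_iff[OF y] by simp
      then have "x \<otimes> inv y \<notin> P 1" using P_unit_iff[of "inv y" x 1] False x by (simp add: m_comm)
      then show ?thesis using lines_unit[OF v x, of 1] j by simp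
    qed
    then show ?thesis using lines_unit[OF u y, of 0] u y h False by (simp add: f_def G_def)
  qed
  moreover have "f (x \<oplus> s) (y \<oplus> z) = f x y"
    if "x \<in> carrier R" "y \<in> carrier R" "s \<in> P j" "z \<in> P j" for x y s z
    using lines_add that Ginv P_j_pred by (simp add: f_def)
  moreover have "corr f f w1 w2 = of_nat q ^ (2 * n) * D j w1 * D j w2"
    if w: "w1 \<in> carrier R" "w2 \<in> carrier R" for w1 w2
  proof -
    have i: "0 \<le> j - 1" "1 \<le> j - 1" using j by auto
    have GL: "corr (lines 0) G w1 w2 = 0" "corr G (lines 0) w1 w2 = 0"
      using corr_lines_invariant[OF i(1) w] Ginv[of _ _ "\<zero>"] by simp_all
    \<comment> \<open>\<open>corr_lines_invariant\<close> exploits invariance in the second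
      coordinate, so the transposed lines are treated with the coordinates exchanged.\<close>
    have "corr (lines 1) (\<lambda>x y. G y x) w2 w1 = 0" "corr (\<lambda>x y. G y x) (lines 1) w2 w1 = 0"
      using corr_lines_invariant[OF i(2) w(2,1), of "\<lambda>x y. G y x"] Ginv[of _ _ _ "\<zero>"] by simp_all
    then have GM: "corr (\<lambda>x y. lines 1 y x) G w1 w2 = 0" "corr G (\<lambda>x y. lines 1 y x) w1 w2 = 0"
      using corr_swap[of "lines 1" "\<lambda>x y. G y x"] corr_swap[of "\<lambda>x y. G y x" "lines 1"] by simp_all
    have "corr f f w1 w2 = corr (lines 0) (lines 0) w1 w2 + corr (lines 1) (lines 1) w2 w1 + corr G G w1 w2"
      unfolding f_def[abs_def] corr_add_left corr_add_right GL GM corr_lines_cross[OF w]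
        corr_swap[of "lines 1" "lines 1"] by simp
    also have "\<dots> = of_nat q ^ (2 * n) * D j w1 * D j w2"
      unfolding corr_lines_self[OF i(1) w] corr_lines_self[OF i(2) w(2,1)] corr_G[OF w]
    proof -
      obtain N where N: "n = Suc N" using n_pos by (cases n) auto
      show "D (j - 0) w1 * of_nat q ^ (n - 0) * (of_nat q ^ n * D j w2 - of_nat q ^ (n - 1) * D (j - 1) w2) +
        D (j - 1) w2 * of_nat q ^ (n - 1) * (of_nat q ^ n * D j w1 - of_nat q ^ (n - 1) * D (j - 1) w1) +
        of_nat q ^ (2 * n - 2) * D (j - 1) w1 * D (j - 1) w2 = of_nat q ^ (2 * n) * D j w1 * D j w2"
        unfolding N by (simp add: algebra_simps mult_2 mult_2_right power_add)
    qed
    finally show ?thesis .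
  qed
  ultimately have "perfect h j f" by (simp add: perfect_def)
  then show ?thesis by (rule exI[of _ f])
qed

end

section \<open>Vanishing sums of roots of unity\<close>

definition vanishing_sum :: "nat \<Rightarrow> nat \<Rightarrow> bool" where
  "vanishing_sum h N \<longleftrightarrow> (\<exists>c :: nat \<Rightarrow> complex. (\<forall>k. c k ^ h = 1) \<and> (\<Sum>k<N. c k) = 0)"

lemma vanishing_sum_0: "vanishing_sum h 0"
  unfolding vanishing_sum_def by (intro exI[of _ "\<lambda>_. 1"]) simp

lemma vanishing_sum_add:
  assumes "vanishing_sum h M" "vanishing_sum h N"
  shows "vanishing_sum h (M + N)"
proof -
  obtain b c :: "nat \<Rightarrow> complex" where b: "\<And>k. b k ^ h = 1" "(\<Sum>k<M. b k) = 0"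
    and c: "\<And>k. c k ^ h = 1" "(\<Sum>k<N. c k) = 0"
    using assms unfolding vanishing_sum_def by blast
  define a where "a k = (if k < M then b k else c (k - M))" for k
  have "(\<Sum>k<M + N. a k) = (\<Sum>k<M. a k) + (\<Sum>k<N. a (M + k))"
    by (induction N) (simp_all add: add.assoc)
  also have "\<dots> = 0" using b(2) c(2) by (simp add: a_def)
  finally have "(\<Sum>k<M + N. a k) = 0" .
  moreover have "a k ^ h = 1" for k using b(1) c(1) by (simp add: a_def)
  ultimately show ?thesis unfolding vanishing_sum_def by blast
qed

lemma vanishing_sum_mult: "vanishing_sum h M \<Longrightarrow> vanishing_sum h (M * a)"
  by (induction a) (auto intro: vanishing_sum_0 vanishing_sum_add)

lemma vanishing_sum_sum:
  assumes "\<And>i. i \<in> A \<Longrightarrow> vanishing_sum h (f i)"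
  shows "vanishing_sum h (\<Sum>i\<in>A. f i)"
  using assms by (induction A rule: infinite_finite_induct) (auto intro: vanishing_sum_0 vanishing_sum_add)

text \<open>The powers of a primitive \<open>M\<close>th root of unity sum to zero by the geometric
  series.\<close>

lemma vanishing_sum_dvd:
  assumes "M dvd h" "M > 1"
  shows "vanishing_sum h M"
proof -
  define w where "w = cis (2 * pi / real M)"
  have wM: "w ^ M = 1" using assms(2) by (simp add: w_def DeMoivre)
  have w1: "w \<noteq> 1"
  proof
    assume "w = 1"
    \<comment> \<open>There are \<open>M > 1\<close> distinct \<open>M\<close>th roots of unity, all
      of them powers of \<open>w\<close>, so \<open>w\<close> cannot be 1.\<close>
    have "card {z::complex. z ^ M = 1} = M" using assms(2) by (intro card_roots_unity_eq) auto
    have "{z::complex. z ^ M = 1} = (\<lambda>k. cis (2 * pi * real k / real M)) ` {..<M}"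
      using bij_betw_roots_unity[of M] assms(2) by (auto simp: bij_betw_def)
    also have "\<dots> = (\<lambda>k. w ^ k) ` {..<M}"
      by (simp add: w_def DeMoivre mult.commute)
    also have "\<dots> \<subseteq> {1}" using \<open>w = 1\<close> by auto
    finally have "card {z::complex. z ^ M = 1} \<le> card {1::complex}" by (intro card_mono) auto
    then show False using \<open>card _ = M\<close> assms(2) by simp
  qed
  have "(w ^ k) ^ h = 1" for k
  proof -
    obtain r where "h = M * r" using assms(1) by blast
    then have "(w ^ k) ^ h = ((w ^ M) ^ r) ^ k" by (metis mult.commute power_mult)
    then show ?thesis using wM by simp
  qed
  moreover have "(\<Sum>k<M. w ^ k) = 0"
    using geometric_sum[OF w1, of M] wM by simp
  ultimately show ?thesis unfolding vanishing_sum_def by blast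
qed

section \<open>Construction of balanced functions\<close>

context finite_chain_ring begin

text \<open>The predicate handed to the choice operator depends on \<open>x\<close> only through its
  coset, so the chosen representative does too.\<close>

lemma coset_representatives:
  obtains \<rho> where "\<And>x. x \<in> carrier R \<Longrightarrow> \<rho> x \<in> carrier R \<and> x \<ominus> \<rho> x \<in> P i"
    and "\<And>x s. x \<in> carrier R \<Longrightarrow> s \<in> P i \<Longrightarrow> \<rho> (x \<oplus> s) = \<rho> x"
proof
  define \<rho> where "\<rho> x = (SOME z. z \<in> carrier R \<and> x \<ominus> z \<in> P i)" for x
  show "\<rho> x \<in> carrier R \<and> x \<ominus> \<rho> x \<in> P i" if "x \<in> carrier R" for x
    unfolding \<rho>_def by (rule someI[of _ x]) (use that in \<open>simp add: a_minus_def r_neg\<close>)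
  show "\<rho> (x \<oplus> s) = \<rho> x" if x: "x \<in> carrier R" and s: "s \<in> P i" for x s
  proof -
    have "x \<oplus> s \<ominus> z \<in> P i \<longleftrightarrow> x \<ominus> z \<in> P i" if z: "z \<in> carrier R" for z
    proof -
      have "x \<oplus> s \<ominus> z = (x \<ominus> z) \<oplus> s" using x z P_closed[OF s] by algebra
      then show ?thesis using P_add_iff[OF s] x z by simp
    qed
    then have "(\<lambda>z. z \<in> carrier R \<and> x \<oplus> s \<ominus> z \<in> P i) = (\<lambda>z. z \<in> carrier R \<and> x \<ominus> z \<in> P i)" by blast
    then show ?thesis by (simp add: \<rho>_def)
  qed
qed

text \<open>There are \<open>q\<close> cosets of \<open>P 1\<close>, each of size
  \<open>q ^ (n - 1)\<close>. Assigning the \<open>q\<close> roots of a vanishing sum to them, one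
  each, makes the total sum a multiple of zero.\<close>

lemma balanced_mod_maximal:
  assumes "vanishing_sum h q"
  obtains \<gamma> :: "'a \<Rightarrow> complex" where "\<And>x. \<gamma> x ^ h = 1"
    and "\<And>x s. x \<in> carrier R \<Longrightarrow> s \<in> P 1 \<Longrightarrow> \<gamma> (x \<oplus> s) = \<gamma> x"
    and "(\<Sum>x\<in>carrier R. \<gamma> x) = 0"
proof -
  obtain c :: "nat \<Rightarrow> complex" where c: "\<And>k. c k ^ h = 1" "(\<Sum>k<q. c k) = 0"
    using assms by (auto simp: vanishing_sum_def)
  obtain \<rho> where \<rho>: "\<And>x. x \<in> carrier R \<Longrightarrow> \<rho> x \<in> carrier R \<and> x \<ominus> \<rho> x \<in> P 1"
    and \<rho>_add: "\<And>x s. x \<in> carrier R \<Longrightarrow> s \<in> P 1 \<Longrightarrow> \<rho> (x \<oplus> s) = \<rho> x"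
    using coset_representatives[of 1] by blast
  define T where "T = \<rho> ` carrier R"
  have T: "finite T" by (simp add: T_def finite_carrier)
  have fibre: "card {x \<in> carrier R. \<rho> x = t} = q ^ (n - 1)" if t: "t \<in> T" for t
  proof -
    obtain a where a: "a \<in> carrier R" "t = \<rho> a" using t by (auto simp: T_def)
    have "bij_betw (\<lambda>s. s \<oplus> a) (P 1) {x \<in> carrier R. \<rho> x = t}"
    proof (rule bij_betwI[where g = "\<lambda>x. x \<ominus> a"])
      show "(\<lambda>s. s \<oplus> a) \<in> P 1 \<rightarrow> {x \<in> carrier R. \<rho> x = t}"
      proof
        fix s assume s: "s \<in> P 1"
        then have "s \<oplus> a = a \<oplus> s" using a P_closed by (simp add: a_comm)
        then show "s \<oplus> a \<in> {x \<in> carrier R. \<rho> x = t}" using \<rho>_add[OF a(1) s] a P_closed[OF s] by simp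
      qed
      show "(\<lambda>x. x \<ominus> a) \<in> {x \<in> carrier R. \<rho> x = t} \<rightarrow> P 1"
      proof
        fix x assume "x \<in> {x \<in> carrier R. \<rho> x = t}"
        then have x: "x \<in> carrier R" "\<rho> x = \<rho> a" using a by auto
        have "(x \<ominus> \<rho> x) \<ominus> (a \<ominus> \<rho> a) \<in> P 1" 
          by (rule P_diff[OF conjunct2[OF \<rho>[OF x(1)]] conjunct2[OF \<rho>[OF a(1)]]])
        moreover have "(x \<ominus> \<rho> a) \<ominus> (a \<ominus> \<rho> a) = x \<ominus> a" using x(1) a(1) \<rho>[OF a(1)] by algebra
        ultimately show "x \<ominus> a \<in> P 1" using x by simp
      qed
    next
      fix s assume "s \<in> P 1"
      then have "s \<in> carrier R" by (rule P_closed)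
      with a(1) show "s \<oplus> a \<ominus> a = s" by algebra
    next
      fix s assume "s \<in> {x \<in> carrier R. \<rho> x = t}"
      then have "s \<in> carrier R" by auto
      with a(1) show "s \<ominus> a \<oplus> a = s" by algebra
    qed
    then have "card {x \<in> carrier R. \<rho> x = t} = card (P 1)" by (metis bij_betw_same_card)
    then show ?thesis using n_pos by (simp add: card_P)
  qed
  have sum_fibre: "(\<Sum>x\<in>carrier R. F (\<rho> x)) = of_nat q ^ (n - 1) * (\<Sum>t\<in>T. F t)" for F :: "'a \<Rightarrow> complex"
  proof -
    have "(\<Sum>x\<in>carrier R. F (\<rho> x)) = (\<Sum>t\<in>T. \<Sum>x | x \<in> carrier R \<and> \<rho> x = t. F (\<rho> x))"
      by (rule sum.group[symmetric]) (auto simp: T_def finite_carrier)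
    also have "\<dots> = (\<Sum>t\<in>T. of_nat q ^ (n - 1) * F t)"
      using fibre by (intro sum.cong) auto
    finally show ?thesis by (simp add: sum_distrib_left)
  qed
  \<comment> \<open>The constant function 1 in \<open>sum_fibre\<close> counts the ring and so
    yields the number of cosets.\<close>
  have "of_nat (q ^ n) = (of_nat (q ^ (n - 1) * card T) :: complex)"
    using sum_fibre[of "\<lambda>_. 1"] by (simp add: card_carrier)
  then have "q ^ n = q ^ (n - 1) * card T" by (simp only: of_nat_eq_iff)
  moreover have "q ^ n = q ^ (n - 1) * q" using n_pos by (simp flip: power_Suc2)
  ultimately have "card T = q" using q_pos by simp
  then obtain b where b: "bij_betw b T {..<q}"
    using ex_bij_betw_finite_nat[OF T] by (auto simp: atLeast0LessThan)
  show thesis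
  proof (rule that[of "\<lambda>x. c (b (\<rho> x))"])
    show "(\<Sum>x\<in>carrier R. c (b (\<rho> x))) = 0"
      using sum_fibre[of "\<lambda>t. c (b t)"] sum.reindex_bij_betw[OF b, of c] c(2) by simp
  qed (use c(1) \<rho>_add in auto)
qed

text \<open>Each \<open>t\<close> is
  \<open>\<rho> t \<oplus> \<pi> [^] (j - 1) \<otimes> e t\<close>, and \<open>\<phi> t\<close> is
  \<open>\<gamma> (e t)\<close>: a function of the digit of \<open>t\<close> in position
  \<open>j - 1\<close>. As \<open>t\<close> runs through a coset of \<open>P (j - 1)\<close>, this
  digit takes all residues equally often.\<close>

lemma balanced_function_exists:
  assumes "vanishing_sum h q" "h > 0" and j: "0 < j" "j \<le> n"
  obtains \<phi> where "balanced_function R \<pi> n q j \<phi>" "\<forall>t\<in>carrier R. \<phi> t ^ h = 1"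
proof -
  obtain \<gamma> :: "'a \<Rightarrow> complex" where \<gamma>: "\<And>x. \<gamma> x ^ h = 1"
    and \<gamma>_add: "\<And>x s. x \<in> carrier R \<Longrightarrow> s \<in> P 1 \<Longrightarrow> \<gamma> (x \<oplus> s) = \<gamma> x"
    and \<gamma>_sum: "(\<Sum>x\<in>carrier R. \<gamma> x) = 0"
    using balanced_mod_maximal[OF assms(1)] by blast
  obtain \<rho> where \<rho>: "\<And>x. x \<in> carrier R \<Longrightarrow> \<rho> x \<in> carrier R \<and> x \<ominus> \<rho> x \<in> P (j - 1)"
    and \<rho>_add: "\<And>x s. x \<in> carrier R \<Longrightarrow> s \<in> P (j - 1) \<Longrightarrow> \<rho> (x \<oplus> s) = \<rho> x"
    using coset_representatives[of "j - 1"] by blast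
  define e where "e t = (SOME z. z \<in> carrier R \<and> t \<ominus> \<rho> t = \<pi> [^] (j - 1) \<otimes> z)" for t
  have e: "e t \<in> carrier R" "t \<ominus> \<rho> t = \<pi> [^] (j - 1) \<otimes> e t" if "t \<in> carrier R" for t
  proof -
    have "\<exists>z. z \<in> carrier R \<and> t \<ominus> \<rho> t = \<pi> [^] (j - 1) \<otimes> z" using \<rho>[OF that] by (auto simp: P_def)
    then have "e t \<in> carrier R \<and> t \<ominus> \<rho> t = \<pi> [^] (j - 1) \<otimes> e t" unfolding e_def by (rule someI_ex)
    then show "e t \<in> carrier R" "t \<ominus> \<rho> t = \<pi> [^] (j - 1) \<otimes> e t" by auto
  qed
  \<comment> \<open>Adding \<open>\<pi> [^] (j - 1) \<otimes> x\<close> keeps the representative and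
    adds \<open>x\<close> to the digit. The digit is ambiguous only by elements that
    \<open>\<pi> [^] (j - 1)\<close> annihilates; they lie in \<open>P 1\<close>, and
    \<open>\<gamma>\<close> ignores them.\<close>
  have shift: "\<gamma> (e (t \<oplus> \<pi> [^] (j - 1) \<otimes> x)) = \<gamma> (e t \<oplus> x)"
    if t: "t \<in> carrier R" and x: "x \<in> carrier R" for t x
  proof -
    let ?s = "\<pi> [^] (j - 1) \<otimes> x" let ?z = "e (t \<oplus> ?s)"
    have tc: "t \<oplus> ?s \<in> carrier R" "?z \<in> carrier R" "e t \<in> carrier R" "\<rho> t \<in> carrier R"
      using t x e \<rho> by auto
    have p: "\<pi> [^] (j - 1) \<in> carrier R" by simp
    have "\<pi> [^] (j - 1) \<otimes> (?z \<ominus> (e t \<oplus> x)) = \<pi> [^] (j - 1) \<otimes> ?z \<ominus> \<pi> [^] (j - 1) \<otimes> e t \<ominus> ?s"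
      using tc p x by algebra
    also have "\<dots> = (t \<oplus> ?s \<ominus> \<rho> t) \<ominus> (t \<ominus> \<rho> t) \<ominus> ?s"
      using e(2)[OF tc(1)] e(2)[OF t] \<rho>_add[OF t P_I[OF x]] by simp
    also have "\<dots> = \<zero>" using t x tc(4) p by algebra
    finally have "?z \<ominus> (e t \<oplus> x) \<in> P 1"
      using pi_pow_mult_mem_iff[of "?z \<ominus> (e t \<oplus> x)" j "j - 1"] tc x j by simp
    then have "\<gamma> ((e t \<oplus> x) \<oplus> (?z \<ominus> (e t \<oplus> x))) = \<gamma> (e t \<oplus> x)" using \<gamma>_add tc x by simp
    moreover have "(e t \<oplus> x) \<oplus> (?z \<ominus> (e t \<oplus> x)) = ?z" using tc x by algebra
    ultimately show ?thesis by simp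
  qed
  show thesis
  proof
    show "balanced_function R \<pi> n q j (\<lambda>t. \<gamma> (e t))"
    proof
      fix t s assume t: "t \<in> carrier R" and s: "s \<in> P j"
      obtain a where a: "a \<in> carrier R" "s = \<pi> [^] j \<otimes> a" using s by (auto simp: P_def)
      have "j = (j - 1) + 1" using j by simp
      then have "\<pi> [^] j = \<pi> [^] (j - 1) \<otimes> \<pi> [^] (1::nat)" by (metis nat_pow_mult pi_closed)
      then have "s = \<pi> [^] (j - 1) \<otimes> (\<pi> \<otimes> a)" using a by (simp add: m_assoc)
      then show "\<gamma> (e (t \<oplus> s)) = \<gamma> (e t)"
        using shift[OF t, of "\<pi> \<otimes> a"] \<gamma>_add[of "e t" "\<pi> \<otimes> a"] e(1)[OF t] a P_I[of a 1] by simp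
    next
      fix t assume t: "t \<in> carrier R"
      have "of_nat (card (P (n - (j - 1)))) * (\<Sum>s\<in>P (j - 1). \<gamma> (e (t \<oplus> s)))
          = (\<Sum>x\<in>carrier R. \<gamma> (e (t \<oplus> \<pi> [^] (j - 1) \<otimes> x)))"
        using j by (intro sum_pi_pow_mult[symmetric]) simp
      also have "\<dots> = (\<Sum>x\<in>carrier R. \<gamma> (x \<oplus> e t))"
        using shift t e by (intro sum.cong) (auto simp: a_comm)
      also have "\<dots> = 0" using sum_shift_carrier[of "e t" \<gamma>] \<gamma>_sum e(1)[OF t] by simp
      finally show "(\<Sum>s\<in>P (j - 1). \<gamma> (e (t \<oplus> s))) = 0" using card_P_nonzero by simp
    next
      fix t assume "t \<in> carrier R"
      have "norm (\<gamma> (e t)) ^ h = 1" using \<gamma> by (metis norm_one norm_power)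
      then have "norm (\<gamma> (e t)) = 1" 
        using power_eq_imp_eq_base[of "norm (\<gamma> (e t))" h 1] assms(2) by simp
      moreover have "\<gamma> (e t) * cnj (\<gamma> (e t)) = of_real ((norm (\<gamma> (e t)))\<^sup>2)"
        by (rule complex_norm_square[symmetric])
      ultimately show "\<gamma> (e t) * cnj (\<gamma> (e t)) = 1" by simp
    qed (use j in auto)
  qed (use \<gamma> in auto)
qed

section \<open>The induction and the resulting matrix\<close>

lemma perfect_exists:
  assumes "vanishing_sum h q" "h > 0"
  shows "j \<le> n \<Longrightarrow> \<exists>f. perfect h j f"
proof (induction j rule: less_induct)
  case (less j)
  show ?case
  proof (cases "j = 0")
    case True
    then show ?thesis using perfect_0[of h] by (intro exI[of _ "\<lambda>_ _. 1"]) simp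
  next
    case False
    then have "0 < j" by simp
    \<comment> \<open>Each level of the induction has its own \<open>\<phi>\<close>, balanced
      relative to that \<open>j\<close>.\<close>
    then obtain \<phi> where \<phi>: "balanced_function R \<pi> n q j \<phi>" "\<forall>t\<in>carrier R. \<phi> t ^ h = 1"
      by (rule balanced_function_exists[OF assms _ less.prems])
    interpret B: balanced_function R \<pi> n q j \<phi> by (rule \<phi>(1))
    show ?thesis
    proof (cases "j = 1")
      case True
      show ?thesis by (rule B.perfect_1[OF _ True]) (simp add: \<phi>(2))
    next
      case False
      with \<open>j \<noteq> 0\<close> have "j \<ge> 2" "j - 2 < j" by auto
      moreover have "j - 2 \<le> n" using less.prems by simp
      ultimately have "\<exists>g. perfect h (j - 2) g" using less.IH[of "j - 2"] by simp
      then obtain g where "perfect h (j - 2) g" by (rule exE)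
      then show ?thesis by (rule B.perfect_step[OF _ \<open>j \<ge> 2\<close>, rotated]) (simp add: \<phi>(2))
    qed
  qed
qed

text \<open>Entries that depend only on the difference of the indices give an invariant matrix, and
  the inner product of the rows \<open>g\<close> and \<open>k\<close> is the autocorrelation of
  \<open>f\<close> at their difference. As \<open>P n\<close> is zero, this vanishes for distinct
  rows.\<close>

lemma BH_matrix_exists:
  assumes "vanishing_sum h q" "h > 0"
  shows "\<exists>H. BH_matrix (add_monoid R \<times>\<times> add_monoid R) h H"
proof -
  obtain f where f: "perfect h n f" using perfect_exists[OF assms, of n] by auto
  have root: "f x y ^ h = 1" if "x \<in> carrier R" "y \<in> carrier R" for x y
    using f that by (simp add: perfect_def)
  have corr: "corr f f w1 w2 = of_nat q ^ (2 * n) * D n w1 * D n w2"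
    if "w1 \<in> carrier R" "w2 \<in> carrier R" for w1 w2
    using f that by (simp add: perfect_def)
  define H where "H g k = f (fst g \<ominus> fst k) (snd g \<ominus> snd k)" for g k
  have "BH_matrix (add_monoid R \<times>\<times> add_monoid R) h H"
    unfolding BH_matrix_def group_invariant_def
  proof (intro conjI ballI)
    fix g k l
    assume "g \<in> carrier (add_monoid R \<times>\<times> add_monoid R)" "k \<in> carrier (add_monoid R \<times>\<times> add_monoid R)"
      "l \<in> carrier (add_monoid R \<times>\<times> add_monoid R)"
    moreover have "(a \<oplus> c) \<ominus> (b \<oplus> c) = a \<ominus> b" if "a \<in> carrier R" "b \<in> carrier R" "c \<in> carrier R" for a b c
      using that by algebra
    ultimately show "H (g \<otimes>\<^bsub>add_monoid R \<times>\<times> add_monoid R\<^esub> l) (k \<otimes>\<^bsub>add_monoid R \<times>\<times> add_monoid R\<^esub> l) = H g k"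
      by (auto simp: H_def)
  next
    fix g k
    assume "g \<in> carrier (add_monoid R \<times>\<times> add_monoid R)" "k \<in> carrier (add_monoid R \<times>\<times> add_monoid R)"
    then show "H g k ^ h = 1" by (auto simp: H_def intro!: root)
  next
    fix g k
    assume "g \<in> carrier (add_monoid R \<times>\<times> add_monoid R)" "k \<in> carrier (add_monoid R \<times>\<times> add_monoid R)"
    then obtain g1 g2 k1 k2 where gk: "g = (g1, g2)" "k = (k1, k2)"
      and c: "g1 \<in> carrier R" "g2 \<in> carrier R" "k1 \<in> carrier R" "k2 \<in> carrier R"
      by (cases g, cases k) auto
    let ?F = "\<lambda>x y. f (x \<oplus> (g1 \<ominus> k1)) (y \<oplus> (g2 \<ominus> k2)) * cnj (f x y)"
    \<comment> \<open>The summation variable enters with a minus sign; the reflection in the second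
      row index turns the inner product into \<open>corr\<close>.\<close>
    have reflect: "(\<Sum>x\<in>carrier R. F (a \<ominus> x)) = (\<Sum>x\<in>carrier R. F x)"
      if a: "a \<in> carrier R" for a and F :: "'a \<Rightarrow> complex"
    proof (rule sum.reindex_bij_witness[of _ "\<lambda>x. a \<ominus> x" "\<lambda>x. a \<ominus> x"])
      fix x assume "x \<in> carrier R"
      with a show "a \<ominus> (a \<ominus> x) = x" "a \<ominus> (a \<ominus> x) = x" by algebra+
    qed (use a in auto)
    have "(\<Sum>l\<in>carrier (add_monoid R \<times>\<times> add_monoid R). H g l * cnj (H k l))
      = (\<Sum>x\<in>carrier R. \<Sum>y\<in>carrier R. f (g1 \<ominus> x) (g2 \<ominus> y) * cnj (f (k1 \<ominus> x) (k2 \<ominus> y)))"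
      by (simp add: H_def gk sum.cartesian_product case_prod_unfold)
    also have "\<dots> = (\<Sum>x\<in>carrier R. \<Sum>y\<in>carrier R. ?F (k1 \<ominus> x) (k2 \<ominus> y))"
    proof (intro sum.cong refl)
      fix x y assume xy: "x \<in> carrier R" "y \<in> carrier R"
      have "(k1 \<ominus> x) \<oplus> (g1 \<ominus> k1) = g1 \<ominus> x" "(k2 \<ominus> y) \<oplus> (g2 \<ominus> k2) = g2 \<ominus> y" using xy c by algebra+
      then show "f (g1 \<ominus> x) (g2 \<ominus> y) * cnj (f (k1 \<ominus> x) (k2 \<ominus> y)) = ?F (k1 \<ominus> x) (k2 \<ominus> y)" by simp
    qed
    also have "\<dots> = (\<Sum>x\<in>carrier R. \<Sum>y\<in>carrier R. ?F (k1 \<ominus> x) y)"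
      by (rule sum.cong[OF refl reflect[OF c(4)]])
    also have "\<dots> = (\<Sum>x\<in>carrier R. \<Sum>y\<in>carrier R. ?F x y)"
      by (rule reflect[OF c(3), of "\<lambda>x. \<Sum>y\<in>carrier R. ?F x y"])
    also have "\<dots> = corr f f (g1 \<ominus> k1) (g2 \<ominus> k2)"
      unfolding corr_def ..
    also have "\<dots> = of_nat q ^ (2 * n) * D n (g1 \<ominus> k1) * D n (g2 \<ominus> k2)"
      using c by (intro corr) auto
    also have "\<dots> = (if g = k then of_nat (Coset.order (add_monoid R \<times>\<times> add_monoid R)) else 0)"
      using c gk r_right_minus_eq[of g1 k1] r_right_minus_eq[of g2 k2]
      by (auto simp: D_def Coset.order_def card_cartesian_product card_carrier power_add mult_2)
    finally show "(\<Sum>l\<in>carrier (add_monoid R \<times>\<times> add_monoid R). H g l * cnj (H k l))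
      = (if g = k then of_nat (Coset.order (add_monoid R \<times>\<times> add_monoid R)) else 0)" .
  qed
  then show ?thesis by (rule exI[of _ H])
qed

end

section \<open>Units of the local ring and the final assembly\<close>

lemma (in cring) unit_or_multiple_of_generator:
  assumes fin: "finite (carrier R)" and max: "maximalideal (Idl {a}) R"
    and a: "a \<in> carrier R" and nil: "a [^] (n::nat) = \<zero>" and x: "x \<in> carrier R"
  shows "x \<in> Units R \<or> (\<exists>y\<in>carrier R. x = a \<otimes> y)"
proof -
  let ?I = "Idl {a}" and ?X = "PIdl x"
  have I: "?I = PIdl a" using cgenideal_eq_genideal[OF a] by simp
  interpret I: maximalideal ?I R by (rule max)
  have X: "ideal ?X R" by (rule cgenideal_ideal[OF x])
  have sum: "ideal (?I <+> ?X) R" by (rule add_ideals[OF I.is_ideal X])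
  have subI: "?I \<subseteq> ?I <+> ?X"
  proof
    fix i assume "i \<in> ?I"
    moreover have "\<zero> \<in> ?X" using X by (simp add: additive_subgroup.zero_closed ideal.axioms(1))
    ultimately show "i \<in> ?I <+> ?X" using I.a_Hcarr by (force simp: set_add_def')
  qed
  have subX: "x \<in> ?I <+> ?X"
  proof -
    have "\<zero> \<in> ?I" "x \<in> ?X" using cgenideal_self[OF x] by auto
    then have "\<zero> \<oplus> x \<in> ?I <+> ?X" unfolding set_add_def' by blast
    then show ?thesis using x by simp
  qed
  \<comment> \<open>By maximality, either \<open>x\<close> is a multiple of \<open>a\<close>, or
    \<open>x\<close> and \<open>a\<close> together generate the whole ring.\<close>
  have "?I <+> ?X = ?I \<or> ?I <+> ?X = carrier R"
    using sum subI by (intro I.I_maximal) (auto dest: ideal.Icarr)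
  then show ?thesis
  proof
    assume "?I <+> ?X = ?I"
    then have "x \<in> PIdl a" using subX I by simp
    then show ?thesis using a by (auto simp: cgenideal_def m_comm)
  next
    assume "?I <+> ?X = carrier R"
    then have "\<one> \<in> ?I <+> ?X" by simp
    then obtain b c where b: "b \<in> carrier R" and c: "c \<in> carrier R" and one: "\<one> = b \<otimes> a \<oplus> c \<otimes> x"
      unfolding I by (auto simp: set_add_def' cgenideal_def)
    \<comment> \<open>From \<open>x \<otimes> z = \<zero>\<close> follows
      \<open>z = (b \<otimes> a) \<otimes> z\<close>, and \<open>n\<close> iterations bring in the
      zero \<open>a [^] n\<close>. So multiplication by \<open>x\<close> is injective, hence
      surjective on a finite ring.\<close>
    have kernel: "z = \<zero>" if z: "z \<in> carrier R" and xz: "x \<otimes> z = \<zero>" for z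
    proof -
      have ba: "z = (b \<otimes> a) \<otimes> z"
      proof -
        have "z = (b \<otimes> a \<oplus> c \<otimes> x) \<otimes> z" using z by (simp add: one[symmetric])
        also have "\<dots> = (b \<otimes> a) \<otimes> z \<oplus> c \<otimes> (x \<otimes> z)" using a b c x z by algebra
        also have "\<dots> = (b \<otimes> a) \<otimes> z" using xz a b c z by simp
        finally show ?thesis .
      qed
      have "z = (b \<otimes> a) [^] k \<otimes> z" for k :: nat
      proof (induction k)
        case (Suc k)
        have "(b \<otimes> a) [^] Suc k \<otimes> z = (b \<otimes> a) [^] k \<otimes> ((b \<otimes> a) \<otimes> z)"
          using a b z by (simp add: m_assoc)
        then show ?case using ba Suc.IH by simp
      qed (use z in simp)
      then have "z = (b [^] n \<otimes> a [^] n) \<otimes> z" using a b by (metis nat_pow_distrib)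
      then show ?thesis using nil b z by simp
    qed
    have "inj_on (\<lambda>z. x \<otimes> z) (carrier R)"
    proof (rule inj_onI)
      fix y z assume yz: "y \<in> carrier R" "z \<in> carrier R" "x \<otimes> y = x \<otimes> z"
      have "x \<otimes> (y \<ominus> z) = x \<otimes> y \<ominus> x \<otimes> z" using x yz(1,2) by algebra
      also have "\<dots> = \<zero>" using x yz by (simp add: a_minus_def r_neg)
      finally show "y = z" using kernel[of "y \<ominus> z"] yz by simp
    qed
    then have "(\<lambda>z. x \<otimes> z) ` carrier R = carrier R"
      using fin x by (intro endo_inj_surj) auto
    then obtain y where "y \<in> carrier R" "x \<otimes> y = \<one>" by (metis imageE one_closed)
    then have "x \<in> Units R" using x m_comm[of x y] by (auto simp: Units_def)
    then show ?thesis by simp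
  qed
qed

theorem theorem4p3:
  fixes R :: "('a, 'b) ring_scheme"
    and I :: "'a set"
    and \<pi> u :: 'a
    and p d m n h r :: nat
    and ps e :: "nat \<Rightarrow> nat"
  assumes "Factorial_Ring.prime p" and "d > 0" and "m > 0" and "n > 0"
    and "finite (carrier R)"
    and "local_ring_with R I"
    and "Coset.order R = p ^ (d * n)"
    and "\<pi> \<in> carrier R" and "I = Idl\<^bsub>R\<^esub> {\<pi>}"
    and "\<pi> [^]\<^bsub>R\<^esub> (n - 1) \<noteq> \<zero>\<^bsub>R\<^esub>" and "\<pi> [^]\<^bsub>R\<^esub> n = \<zero>\<^bsub>R\<^esub>"
    and "u \<in> Units R" and "[p] \<cdot>\<^bsub>R\<^esub> \<one>\<^bsub>R\<^esub> = \<pi> [^]\<^bsub>R\<^esub> m \<otimes>\<^bsub>R\<^esub> u"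
    and "field (R Quot I)" and "Coset.order (R Quot I) = p ^ d"
    and "h > 0"
    and "inj_on ps {1..r}"
    and "\<And>i. i \<in> {1..r} \<Longrightarrow> Factorial_Ring.prime (ps i)"
    and "\<And>i. i \<in> {1..r} \<Longrightarrow> e i > 0"
    and "h = (\<Prod>i=1..r. ps i ^ e i)"
    and "p ^ d \<in> {\<Sum>i=1..r. ps i * a i | a :: nat \<Rightarrow> nat. True}"
  shows "\<exists>H. BH_matrix (add_monoid R \<times>\<times> add_monoid R) h H"
proof -
  have R: "cring R" and max: "maximalideal (Idl\<^bsub>R\<^esub> {\<pi>}) R"
    using assms(6) unfolding local_ring_with_def assms(9) by (rule conjunct1, elim conjE)
  interpret cring R by (rule R)
  interpret finite_chain_ring R \<pi> n "p ^ d"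
  proof
    show "x \<in> Units R \<or> (\<exists>y\<in>carrier R. x = \<pi> \<otimes>\<^bsub>R\<^esub> y)" if "x \<in> carrier R" for x
      using unit_or_multiple_of_generator[OF assms(5) max assms(8,11) that] .
    show "card (carrier R) = (p ^ d) ^ n" using assms(7) by (simp add: Coset.order_def power_mult)
  qed (use assms in auto)
  obtain a where a: "p ^ d = (\<Sum>i=1..r. ps i * a i)" using assms(21) by auto
  \<comment> \<open>Each prime \<open>ps i\<close> divides \<open>h\<close> and so provides a
    vanishing sum of its own length. Taking \<open>a i\<close> copies of it and concatenating over
    \<open>i\<close> gives one of length \<open>p ^ d\<close>.\<close>
  have "vanishing_sum h (\<Sum>i=1..r. ps i * a i)"
  proof (intro vanishing_sum_sum vanishing_sum_mult vanishing_sum_dvd)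
    fix i assume i: "i \<in> {1..r}"
    have "ps i dvd ps i ^ e i" using assms(19)[OF i] by simp
    also have "\<dots> dvd h" unfolding assms(20) using i by (intro dvd_prodI) auto
    finally show "ps i dvd h" .
    show "ps i > 1" using assms(18)[OF i] by (rule prime_gt_1_nat)
  qed
  then show ?thesis using BH_matrix_exists assms(16) a by simp
qed

end
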